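(* Let $M=I\times_{\phi^{p_1}}F_1\times_{\phi^{p_2}}F_2\times_{\phi^{p_3}}F_3$ be a generalized Kasner space-time with $\dim F_1=\dim F_2=\dim F_3=1$. Put $\zeta=p_1+p_2+p_3$ and $\eta=p_1^2+p_2^2+p_3^2$. Let $\lambda_1,\lambda_2$ be nonzero real constants, $P=\frac{\partial}{\partial t}$, and let $\overline\nabla$ be the quarter-symmetric connection on $M$ determined by $P,\lambda_1,\lambda_2$. When $\zeta\neq0$, define $\psi>0$ by $\phi=\psi^{\frac{2\zeta}{\eta+\zeta^2}}$. Then $(M,\overline\nabla)$ has constant scalar curvature $\overline S$ if and only if one of the following conditions is satisfied (for some real constants $c,c_0,c_1,c_2$): (1) $\zeta=\eta=0$ and $\overline S=3(\lambda_1^2+\lambda_2^2-4\lambda_1\lambda_2)$. (2) $\zeta=0$, $\eta\neq0$, and: when $\overline S>3(\lambda_1^2+\lambda_2^2-4\lambda_1\lambda_2)$ there is no solution; when $\overline S=3(\lambda_1^2+\lambda_2^2-4\lambda_1\lambda_2)$, $\phi=c$; when $\overline S<3(\lambda_1^2+\lambda_2^2-4\lambda_1\lambda_2)$, $\phi=c_0e^{\pm\sqrt{\frac{3(\lambda_1^2+\lambda_2^2-4\lambda_1\lambda_2)-\overline S}{\eta}}\,t}$. (3) $\zeta\neq0$, and, with $D=\frac{9(\lambda_1+\lambda_2)^2}{4}-\frac{(\overline S-3\lambda_1^2-3\lambda_2^2+12\lambda_1\lambda_2)(\eta+\zeta^2)}{\zeta^2}$, one of: (a) $\overline S<\frac{9\zeta^2(\lambda_1+\lambda_2)^2}{4(\eta+\zeta^2)}+3\lambda_1^2+3\lambda_2^2-12\lambda_1\lambda_2$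 and $\psi=c_1e^{\frac12\left(\frac32(\lambda_1+\lambda_2)+\sqrt D\right)t}+c_2e^{\frac12\left(\frac32(\lambda_1+\lambda_2)-\sqrt D\right)t}$; (b) $\overline S=\frac{9\zeta^2(\lambda_1+\lambda_2)^2}{4(\eta+\zeta^2)}+3\lambda_1^2+3\lambda_2^2-12\lambda_1\lambda_2$ and $\psi=c_1e^{\frac{3(\lambda_1+\lambda_2)}{4}t}+c_2te^{\frac{3(\lambda_1+\lambda_2)}{4}t}$; (c) $\overline S>\frac{9\zeta^2(\lambda_1+\lambda_2)^2}{4(\eta+\zeta^2)}+3\lambda_1^2+3\lambda_2^2-12\lambda_1\lambda_2$ and $\psi=c_1e^{\frac34(\lambda_1+\lambda_2)t}\cos\left(\tfrac12\sqrt{-D}\,t\right)+c_2e^{\frac34(\lambda_1+\lambda_2)t}\sin\left(\tfrac12\sqrt{-D}\,t\right)$.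
   Context: A generalized Kasner space-time is a Lorentzian multiply warped product $M=I\times_{\phi^{p_1}}F_1\cdots\times_{\phi^{p_m}}F_m$, i.e. the product manifold $I\times F_1\times\cdots\times F_m$ with metric $g=-dt^2\oplus\phi^{2p_1}g_{F_1}\oplus\cdots\oplus\phi^{2p_m}g_{F_m}$, where $I=(t_1,t_2)$ is an open interval, $\phi:I\to(0,\infty)$ is smooth, $p_i\in\mathbb{R}$, and $(F_i,g_{F_i})$ are Riemannian manifolds. On a pseudo-Riemannian manifold $(M,g)$ with Levi-Civita connection $\nabla$, a vector field $P$, the 1-form $\pi(X)=g(X,P)$ and nonzero real constants $\lambda_1,\lambda_2$, the quarter-symmetric connection is $\overline\nabla_XY=\nabla_XY+\lambda_1\pi(Y)X-\lambda_2g(X,Y)P$. Its curvature is $\overline R(X,Y)=\overline\nabla_X\overline\nabla_Y-\overline\nabla_Y\overline\nabla_X-\overline\nabla_{[X,Y]}$, its Ricci tensor is $\overline{Ric}(X,Y)=\sum_k\varepsilon_k\,g(\overline R(X,E_k)Y,E_k)$ and its scalar curvature is $\overline S=\sum_k\varepsilon_k\overline{Ric}(E_k,E_k)$, where $(E_k)$ is a local orthonormal frame with $g(E_k,E_k)=\varepsilon_k=\pm1$ (note the sign convention). *)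

theory Defs
  imports "HOL-Analysis.Analysis"
begin

section \<open>Smooth maps and smooth manifolds\<close>

primrec C_k_on :: "nat \<Rightarrow> 'a::euclidean_space set \<Rightarrow> ('a \<Rightarrow> 'b::real_normed_vector) \<Rightarrow> bool" where
  "C_k_on 0 S f \<longleftrightarrow> continuous_on S f"
| "C_k_on (Suc k) S f \<longleftrightarrow> (\<forall>x\<in>S. f differentiable at x) \<and>
     (\<forall>v. C_k_on k S (\<lambda>x. frechet_derivative f (at x) v))"

text \<open>Only meant for open sets, since the derivatives are taken with respect to the full
  neighbourhood filter.\<close>

definition smooth_on :: "'a::euclidean_space set \<Rightarrow> ('a \<Rightarrow> 'b::real_normed_vector) \<Rightarrow> bool" where
  "smooth_on S f \<longleftrightarrow> (\<forall>k. C_k_on k S f)"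

text \<open>A space of points of type \<^typ>\<open>'p\<close> with an atlas modelled on the Euclidean space \<^typ>\<open>'e\<close>;
  the dimension is that of \<^typ>\<open>'e\<close>. The charts are a family indexed by the set
  \<open>charts\<close>, so that an object on the manifold (a metric, a vector field, a connection)
  is given by the family of its local expressions in these charts.\<close>

record ('p, 'e, 'i) atlas =
  space_top :: "'p topology"
  charts :: "'i set"
  cdom :: "'i \<Rightarrow> 'p set"
  coord :: "'i \<Rightarrow> 'p \<Rightarrow> 'e"

definition cimage :: "('p, 'e, 'i) atlas \<Rightarrow> 'i \<Rightarrow> 'e set" where
  "cimage M i = coord M i ` cdom M i"

definition transition :: "('p, 'e, 'i) atlas \<Rightarrow> 'i \<Rightarrow> 'i \<Rightarrow> 'e \<Rightarrow> 'e" where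
  "transition M i j = coord M j \<circ> inv_into (cdom M i) (coord M i)"

definition smooth_manifold :: "('p, 'e::euclidean_space, 'i) atlas \<Rightarrow> bool" where
  "smooth_manifold M \<longleftrightarrow>
     topspace (space_top M) \<noteq> {} \<and> Hausdorff_space (space_top M) \<and> second_countable (space_top M) \<and>
     (\<Union>i\<in>charts M. cdom M i) = topspace (space_top M) \<and>
     (\<forall>i\<in>charts M. openin (space_top M) (cdom M i) \<and> open (cimage M i) \<and>
        homeomorphic_map (subtopology (space_top M) (cdom M i)) (top_of_set (cimage M i)) (coord M i)) \<and>
     (\<forall>i\<in>charts M. \<forall>j\<in>charts M.
        smooth_on (coord M i ` (cdom M i \<inter> cdom M j)) (transition M i j))"

definition interval_atlas :: "real set \<Rightarrow> (real, real, unit) atlas" where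
  "interval_atlas I = \<lparr>space_top = top_of_set I, charts = {()}, cdom = (\<lambda>_. I), coord = (\<lambda>_ t. t)\<rparr>"

definition prod_atlas ::
  "('p, 'e, 'i) atlas \<Rightarrow> ('q, 'f, 'j) atlas \<Rightarrow> ('p \<times> 'q, 'e \<times> 'f, 'i \<times> 'j) atlas" where
  "prod_atlas M N = \<lparr>space_top = prod_topology (space_top M) (space_top N),
     charts = charts M \<times> charts N,
     cdom = (\<lambda>(i, j). cdom M i \<times> cdom N j),
     coord = (\<lambda>(i, j). map_prod (coord M i) (coord N j))\<rparr>"

section \<open>Metrics and connections\<close>

text \<open>\<open>g x v w\<close> is the value of the metric at the coordinate point \<open>x\<close> on the tangent vectors \<open>v\<close>
  and \<open>w\<close>; \<open>D X Y\<close> is the covariant derivative of \<open>Y\<close> along \<open>X\<close>.\<close>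

type_synonym 'e local_metric = "'e \<Rightarrow> 'e \<Rightarrow> 'e \<Rightarrow> real"
type_synonym 'e local_field = "'e \<Rightarrow> 'e"
type_synonym 'e local_connection = "'e local_field \<Rightarrow> 'e local_field \<Rightarrow> 'e local_field"

definition pseudo_riemannian_metric ::
  "('p, 'e::euclidean_space, 'i) atlas \<Rightarrow> ('i \<Rightarrow> 'e local_metric) \<Rightarrow> bool" where
  "pseudo_riemannian_metric M g \<longleftrightarrow>
     (\<forall>i\<in>charts M.
        (\<forall>x\<in>cimage M i. bilinear (g i x) \<and> (\<forall>v w. g i x v w = g i x w v) \<and>
           (\<forall>v. (\<forall>w. g i x v w = 0) \<longrightarrow> v = 0)) \<and>
        (\<forall>v w. smooth_on (cimage M i) (\<lambda>x. g i x v w))) \<and>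
     (\<forall>i\<in>charts M. \<forall>j\<in>charts M. \<forall>x\<in>coord M i ` (cdom M i \<inter> cdom M j). \<forall>v w.
        g i x v w = g j (transition M i j x)
          (frechet_derivative (transition M i j) (at x) v)
          (frechet_derivative (transition M i j) (at x) w))"

definition riemannian_metric ::
  "('p, 'e::euclidean_space, 'i) atlas \<Rightarrow> ('i \<Rightarrow> 'e local_metric) \<Rightarrow> bool" where
  "riemannian_metric M g \<longleftrightarrow> pseudo_riemannian_metric M g \<and>
     (\<forall>i\<in>charts M. \<forall>x\<in>cimage M i. \<forall>v. v \<noteq> 0 \<longrightarrow> g i x v v > 0)"

definition bracket :: "'e::euclidean_space local_field \<Rightarrow> 'e local_field \<Rightarrow> 'e local_field" where
  "bracket X Y x = frechet_derivative Y (at x) (X x) - frechet_derivative X (at x) (Y x)"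

text \<open>The Christoffel symbols as a vector-valued form: the Koszul formula for
  constant (coordinate) fields \<open>u\<close>, \<open>v\<close>, \<open>w\<close>, whose brackets vanish.\<close>

definition christoffel :: "'e::euclidean_space local_metric \<Rightarrow> 'e \<Rightarrow> 'e \<Rightarrow> 'e \<Rightarrow> 'e" where
  "christoffel g x u v = (THE z. \<forall>w. g x z w =
     (frechet_derivative (\<lambda>y. g y v w) (at x) u + frechet_derivative (\<lambda>y. g y u w) (at x) v
      - frechet_derivative (\<lambda>y. g y u v) (at x) w) / 2)"

definition levi_civita :: "'e::euclidean_space local_metric \<Rightarrow> 'e local_connection" where
  "levi_civita g X Y x = frechet_derivative Y (at x) (X x) + christoffel g x (X x) (Y x)"

definition quarter_symmetric ::
  "'e::euclidean_space local_metric \<Rightarrow> 'e local_field \<Rightarrow> real \<Rightarrow> real \<Rightarrow> 'e local_connection" where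
  "quarter_symmetric g P l1 l2 X Y x =
     levi_civita g X Y x + (l1 * g x (Y x) (P x)) *\<^sub>R X x - (l2 * g x (X x) (Y x)) *\<^sub>R P x"

definition curvature :: "'e::euclidean_space local_connection \<Rightarrow>
    'e local_field \<Rightarrow> 'e local_field \<Rightarrow> 'e local_field \<Rightarrow> 'e local_field" where
  "curvature D X Y Z x = D X (D Y Z) x - D Y (D X Z) x - D (bracket X Y) Z x"

definition orthonormal_frame ::
  "'e::euclidean_space local_metric \<Rightarrow> 'e set \<Rightarrow> (nat \<Rightarrow> 'e local_field) \<Rightarrow> bool" where
  "orthonormal_frame g W E \<longleftrightarrow>
     (\<forall>k<DIM('e). smooth_on W (E k)) \<and>
     (\<forall>x\<in>W. \<forall>j<DIM('e). \<forall>k<DIM('e).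
        (j \<noteq> k \<longrightarrow> g x (E j x) (E k x) = 0) \<and> g x (E k x) (E k x) \<in> {1, -1})"

text \<open>Here \<open>g x (E k x) (E k x)\<close> is the sign \<open>\<epsilon>\<^sub>k\<close>. Mind the position of \<open>E k\<close> in the
  curvature: this is the negative of the more common convention.\<close>

definition ricci :: "'e::euclidean_space local_metric \<Rightarrow> 'e local_connection \<Rightarrow>
    (nat \<Rightarrow> 'e local_field) \<Rightarrow> 'e local_field \<Rightarrow> 'e local_field \<Rightarrow> 'e \<Rightarrow> real" where
  "ricci g D E X Y x =
     (\<Sum>k<DIM('e). g x (E k x) (E k x) * g x (curvature D X (E k) Y x) (E k x))"

text \<open>The value does not depend on the frame (of which there is one near every point of
  \<open>U\<close>), so the description below is proper for a metric \<open>g\<close> on the open set \<open>U\<close>.\<close>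

definition scalar_curvature ::
  "'e::euclidean_space set \<Rightarrow> 'e local_metric \<Rightarrow> 'e local_connection \<Rightarrow> 'e \<Rightarrow> real" where
  "scalar_curvature U g D x = (THE s. \<exists>W E. open W \<and> x \<in> W \<and> W \<subseteq> U \<and> orthonormal_frame g W E \<and>
     s = (\<Sum>k<DIM('e). g x (E k x) (E k x) * ricci g D E (E k) (E k) x))"

definition has_constant_scalar_curvature :: "('p, 'e::euclidean_space, 'i) atlas \<Rightarrow>
    ('i \<Rightarrow> 'e local_metric) \<Rightarrow> ('i \<Rightarrow> 'e local_connection) \<Rightarrow> real \<Rightarrow> bool" where
  "has_constant_scalar_curvature M g D S \<longleftrightarrow>
     (\<forall>i\<in>charts M. \<forall>q\<in>cdom M i. scalar_curvature (cimage M i) (g i) (D i) (coord M i q) = S)"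

section \<open>Generalized Kasner space-times with three fibres\<close>

definition kasner_space :: "real set \<Rightarrow> ('p1, 'e1, 'i1) atlas \<Rightarrow> ('p2, 'e2, 'i2) atlas \<Rightarrow>
    ('p3, 'e3, 'i3) atlas \<Rightarrow>
    (real \<times> 'p1 \<times> 'p2 \<times> 'p3, real \<times> 'e1 \<times> 'e2 \<times> 'e3, unit \<times> 'i1 \<times> 'i2 \<times> 'i3) atlas" where
  "kasner_space I F1 F2 F3 = prod_atlas (interval_atlas I) (prod_atlas F1 (prod_atlas F2 F3))"

definition kasner_metric :: "(real \<Rightarrow> real) \<Rightarrow> real \<Rightarrow> real \<Rightarrow> real \<Rightarrow>
    ('i1 \<Rightarrow> 'e1 local_metric) \<Rightarrow> ('i2 \<Rightarrow> 'e2 local_metric) \<Rightarrow> ('i3 \<Rightarrow> 'e3 local_metric) \<Rightarrow>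
    unit \<times> 'i1 \<times> 'i2 \<times> 'i3 \<Rightarrow> (real \<times> 'e1 \<times> 'e2 \<times> 'e3) local_metric" where
  "kasner_metric \<phi> p1 p2 p3 g1 g2 g3 =
     (\<lambda>(_, i1, i2, i3) (t, x1, x2, x3) (a, v1, v2, v3) (b, w1, w2, w3).
        - (a * b) + \<phi> t powr (2 * p1) * g1 i1 x1 v1 w1
          + \<phi> t powr (2 * p2) * g2 i2 x2 v2 w2
          + \<phi> t powr (2 * p3) * g3 i3 x3 v3 w3)"

definition d_dt :: "(real \<times> 'e::real_vector) local_field" where
  "d_dt x = (1, 0)"

section \<open>The Levi-Civita connection is metric and torsion-free\<close>

lemma frechet_derivative_local_eq:
  assumes "open U" "x \<in> U" "\<And>y. y \<in> U \<Longrightarrow> f y = h y" "h differentiable at x"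
  shows "frechet_derivative f (at x) = frechet_derivative h (at x)"
proof -
  have "(h has_derivative frechet_derivative h (at x)) (at x)"
    using assms(4) frechet_derivative_works by blast
  then have "(f has_derivative frechet_derivative h (at x)) (at x)"
    using has_derivative_transform_within_open[OF _ assms(1,2), of h _ UNIV f] assms(3) by simp
  then show ?thesis
    by (rule frechet_derivative_at[symmetric])
qed

lemma represent_functional:
  fixes b :: "'e::euclidean_space \<Rightarrow> 'e \<Rightarrow> real"
  assumes bil: "bilinear b" and nondeg: "\<And>v. (\<And>w. b v w = 0) \<Longrightarrow> v = 0" and F: "linear F"
  shows "\<exists>!z. \<forall>w. b z w = F w"
proof -
  define L where "L = (\<lambda>z. \<Sum>e\<in>Basis. b z e *\<^sub>R e)"
  have L_inner: "L z \<bullet> e = b z e" if "e \<in> Basis" for z e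
    using that by (simp add: L_def)
  have expand: "b z w = (\<Sum>e\<in>Basis. (w \<bullet> e) * b z e)" for z w
  proof -
    have "linear (b z)" using bil by (simp add: bilinear_def)
    then have "b z (\<Sum>e\<in>Basis. (w \<bullet> e) *\<^sub>R e) = (\<Sum>e\<in>Basis. (w \<bullet> e) * b z e)"
      by (simp add: linear_sum linear_scale)
    then show ?thesis by (simp add: euclidean_representation)
  qed
  have Fexpand: "F w = (\<Sum>e\<in>Basis. (w \<bullet> e) * F e)" for w
  proof -
    have "F (\<Sum>e\<in>Basis. (w \<bullet> e) *\<^sub>R e) = (\<Sum>e\<in>Basis. (w \<bullet> e) * F e)"
      using F by (simp add: linear_sum linear_scale)
    then show ?thesis by (simp add: euclidean_representation)
  qed
  have linL: "linear L"
    by (rule linearI)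
       (simp_all add: L_def bilinear_ladd[OF bil] bilinear_lmul[OF bil] scaleR_add_left
          sum.distrib scaleR_sum_right)
  have "inj L"
  proof (subst linear_injective_0[OF linL], intro allI impI)
    fix z assume "L z = 0"
    then have "b z e = 0" if "e \<in> Basis" for e
      using L_inner[OF that, of z] by simp
    then have "b z w = 0" for w by (subst expand) simp
    then show "z = 0" by (rule nondeg)
  qed
  then have "surj L" using linL linear_injective_imp_surjective by blast
  from surjD[OF this] obtain z where z: "L z = (\<Sum>e\<in>Basis. F e *\<^sub>R e)"
    by (metis (lifting))
  have "b z e = F e" if "e \<in> Basis" for e
    using L_inner[OF that, of z] that by (simp add: z)
  then have 1: "\<forall>w. b z w = F w" by (subst expand, subst Fexpand) simp
  have 2: "z' = z" if "\<forall>w. b z' w = F w" for z'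
  proof -
    have "z' - z = 0"
      by (rule nondeg) (simp add: bilinear_lsub[OF bil] that 1)
    then show ?thesis by simp
  qed
  show ?thesis using 1 2 by blast
qed

context
  fixes g :: "'e::euclidean_space local_metric" and U :: "'e set" and x :: 'e
  assumes U: "open U" "x \<in> U"
    and bil: "\<And>y. y \<in> U \<Longrightarrow> bilinear (g y)"
    and sym: "\<And>y v w. y \<in> U \<Longrightarrow> g y v w = g y w v"
    and nondeg: "\<And>v. (\<And>w. g x v w = 0) \<Longrightarrow> v = 0"
    and diff: "\<And>v w. (\<lambda>y. g y v w) differentiable at x"
begin

lemma deriv_metric_sym:
  "frechet_derivative (\<lambda>y. g y v w) (at x) = frechet_derivative (\<lambda>y. g y w v) (at x)"
  by (rule frechet_derivative_local_eq[OF U sym diff])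

lemma deriv_metric_linear: "linear (\<lambda>w. frechet_derivative (\<lambda>y. g y v w) (at x) u)"
proof (rule linearI)
  fix w w' :: 'e and r :: real
  have "frechet_derivative (\<lambda>y. g y v (w + w')) (at x)
      = frechet_derivative (\<lambda>y. g y v w + g y v w') (at x)"
    by (rule frechet_derivative_local_eq[OF U]) (simp_all add: bil bilinear_radd diff)
  then show "frechet_derivative (\<lambda>y. g y v (w + w')) (at x) u
      = frechet_derivative (\<lambda>y. g y v w) (at x) u + frechet_derivative (\<lambda>y. g y v w') (at x) u"
    using frechet_derivative_at[OF has_derivative_add[OF
        iffD1[OF frechet_derivative_works diff] iffD1[OF frechet_derivative_works diff]]]
    by (simp add: fun_eq_iff)
  have "frechet_derivative (\<lambda>y. g y v (r *\<^sub>R w)) (at x)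
      = frechet_derivative (\<lambda>y. r *\<^sub>R g y v w) (at x)"
    by (rule frechet_derivative_local_eq[OF U]) (simp_all add: bil bilinear_rmul diff)
  moreover have "((\<lambda>y. r *\<^sub>R g y v w) has_derivative
      (\<lambda>u. r *\<^sub>R frechet_derivative (\<lambda>y. g y v w) (at x) u)) (at x)"
    by (intro has_derivative_scaleR_right iffD1[OF frechet_derivative_works] diff)
  ultimately show "frechet_derivative (\<lambda>y. g y v (r *\<^sub>R w)) (at x) u
      = r *\<^sub>R frechet_derivative (\<lambda>y. g y v w) (at x) u"
    by (simp flip: frechet_derivative_at)
qed

lemma christoffel_koszul:
  "g x (christoffel g x u v) w =
     (frechet_derivative (\<lambda>y. g y v w) (at x) u + frechet_derivative (\<lambda>y. g y u w) (at x) v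
      - frechet_derivative (\<lambda>y. g y u v) (at x) w) / 2"
proof -
  have "linear (\<lambda>w. (frechet_derivative (\<lambda>y. g y v w) (at x) u
      + frechet_derivative (\<lambda>y. g y u w) (at x) v
      - frechet_derivative (\<lambda>y. g y u v) (at x) w) / 2)"
    using linear_compose_scale_right[OF linear_compose_sub[OF linear_compose_add[OF
        deriv_metric_linear[of v u] deriv_metric_linear[of u v]]
        linear_frechet_derivative[OF diff[of u v]]], of "1 / 2"]
    by simp
  from theI'[OF represent_functional[OF bil[OF U(2)] nondeg this]]
  show ?thesis unfolding christoffel_def by blast
qed

lemma levi_civita_torsion_free: "levi_civita g X Y x - levi_civita g Y X x = bracket X Y x"
proof -
  have "christoffel g x u v = christoffel g x v u" for u v
    unfolding christoffel_def by (simp add: deriv_metric_sym[of u v] add.commute)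
  then show ?thesis by (simp add: levi_civita_def bracket_def)
qed

lemma levi_civita_metric:
  assumes Y: "Y differentiable at x" and Z: "Z differentiable at x"
  shows "frechet_derivative (\<lambda>y. g y (Y y) (Z y)) (at x) (X x) =
    g x (levi_civita g X Y x) (Z x) + g x (Y x) (levi_civita g X Z x)"
proof -
  note xb = bil[OF U(2)]
  have expand: "g y v w = (\<Sum>d\<in>Basis. \<Sum>e\<in>Basis. (v \<bullet> d) * (w \<bullet> e) * g y d e)"
    if "y \<in> U" for y v w
  proof -
    have "g y (\<Sum>d\<in>Basis. (v \<bullet> d) *\<^sub>R d) (\<Sum>e\<in>Basis. (w \<bullet> e) *\<^sub>R e)
        = (\<Sum>d\<in>Basis. \<Sum>e\<in>Basis. g y ((v \<bullet> d) *\<^sub>R d) ((w \<bullet> e) *\<^sub>R e))"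
      by (simp add: bilinear_sum[OF bil[OF that]] sum.cartesian_product)
    then show ?thesis
      by (simp add: euclidean_representation bilinear_lmul[OF bil[OF that]]
          bilinear_rmul[OF bil[OF that]] mult.assoc mult.left_commute)
  qed
  define Y' Z' g' where "Y' = frechet_derivative Y (at x)" and "Z' = frechet_derivative Z (at x)"
    and "g' = (\<lambda>d e. frechet_derivative (\<lambda>y. g y d e) (at x))"
  have Yd: "(Y has_derivative Y') (at x)" and Zd: "(Z has_derivative Z') (at x)"
    and gd: "((\<lambda>y. g y d e) has_derivative g' d e) (at x)" for d e
    unfolding Y'_def Z'_def g'_def using Y Z diff by (simp_all flip: frechet_derivative_works)
  have g'expand: "g' v w u = (\<Sum>d\<in>Basis. \<Sum>e\<in>Basis. (v \<bullet> d) * (w \<bullet> e) * g' d e u)" for v w u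
  proof -
    have "((\<lambda>y. \<Sum>d\<in>Basis. \<Sum>e\<in>Basis. (v \<bullet> d) * (w \<bullet> e) * g y d e) has_derivative
        (\<lambda>u. \<Sum>d\<in>Basis. \<Sum>e\<in>Basis. (v \<bullet> d) * (w \<bullet> e) * g' d e u)) (at x)"
      by (intro has_derivative_sum has_derivative_mult_right gd)
    then have "((\<lambda>y. g y v w) has_derivative
        (\<lambda>u. \<Sum>d\<in>Basis. \<Sum>e\<in>Basis. (v \<bullet> d) * (w \<bullet> e) * g' d e u)) (at x)"
      by (rule has_derivative_transform_within_open[OF _ U]) (rule expand[symmetric])
    from has_derivative_unique[OF gd this] show ?thesis by (rule fun_cong)
  qed
  have "((\<lambda>y. \<Sum>d\<in>Basis. \<Sum>e\<in>Basis. (Y y \<bullet> d) * (Z y \<bullet> e) * g y d e) has_derivative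
      (\<lambda>u. \<Sum>d\<in>Basis. \<Sum>e\<in>Basis. (Y x \<bullet> d) * (Z x \<bullet> e) * g' d e u
        + ((Y x \<bullet> d) * (Z' u \<bullet> e) + (Y' u \<bullet> d) * (Z x \<bullet> e)) * g x d e)) (at x)"
    by (intro has_derivative_sum has_derivative_mult gd has_derivative_inner_left Yd Zd)
  then have "((\<lambda>y. g y (Y y) (Z y)) has_derivative
      (\<lambda>u. \<Sum>d\<in>Basis. \<Sum>e\<in>Basis. (Y x \<bullet> d) * (Z x \<bullet> e) * g' d e u
        + ((Y x \<bullet> d) * (Z' u \<bullet> e) + (Y' u \<bullet> d) * (Z x \<bullet> e)) * g x d e)) (at x)"
    by (rule has_derivative_transform_within_open[OF _ U]) (rule expand[symmetric])
  moreover have "(\<Sum>d\<in>Basis. \<Sum>e\<in>Basis. (Y x \<bullet> d) * (Z x \<bullet> e) * g' d e u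
        + ((Y x \<bullet> d) * (Z' u \<bullet> e) + (Y' u \<bullet> d) * (Z x \<bullet> e)) * g x d e)
      = g' (Y x) (Z x) u + g x (Y x) (Z' u) + g x (Y' u) (Z x)" for u
    by (subst g'expand, subst expand[OF U(2), of "Y x" "Z' u"],
        subst expand[OF U(2), of "Y' u" "Z x"]) (simp add: sum.distrib ring_distribs)
  ultimately have der: "((\<lambda>y. g y (Y y) (Z y)) has_derivative
      (\<lambda>u. g' (Y x) (Z x) u + g x (Y x) (Z' u) + g x (Y' u) (Z x))) (at x)" by (simp only:)
  have D: "frechet_derivative (\<lambda>y. g y (Y y) (Z y)) (at x) (X x)
      = g' (Y x) (Z x) (X x) + g x (Y x) (Z' (X x)) + g x (Y' (X x)) (Z x)"
    unfolding frechet_derivative_at[OF der, symmetric] ..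
  have s: "g x (Y x) (christoffel g x (X x) (Z x)) = g x (christoffel g x (X x) (Z x)) (Y x)"
    by (rule sym[OF U(2)])
  have "g' (Y x) (Z x) (X x) = g x (christoffel g x (X x) (Y x)) (Z x)
      + g x (Y x) (christoffel g x (X x) (Z x))"
    unfolding s christoffel_koszul g'_def
    using deriv_metric_sym[of "Z x" "Y x"] by (simp add: field_simps)
  then show ?thesis
    unfolding D by (simp add: levi_civita_def bilinear_ladd[OF xb] bilinear_radd[OF xb]
        Y'_def Z'_def)
qed

end

end

(* The scalar curvature is computed from the connection coefficients of the quarter-symmetric
   connection. Contracting with an orthonormal frame amounts to contracting with the inverse
   metric, so the coordinate frame can be used instead; with f = phi'/phi this gives
     S = -2 zeta f' - (eta + zeta^2) f^2 + 3 (lam1 + lam2) zeta f + 3 (lam1^2 + lam2^2 - 4 lam1 lam2),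
   the fibre coordinates dropping out because one-dimensional fibres are flat. For zeta = 0 the
   condition fixes f^2. For zeta <> 0 the exponent in phi = psi^(2 zeta / (eta + zeta^2)) is
   chosen such that the quadratic terms cancel, which leaves the linear equation
     psi'' - 3/2 (lam1 + lam2) psi' + (S - K) (eta + zeta^2) / (4 zeta^2) psi = 0
   with K = 3 (lam1^2 + lam2^2 - 4 lam1 lam2), whose characteristic discriminant is D. *)

theory Submission
  imports Defs
begin

section \<open>Curvature in coordinates\<close>

text \<open>\<open>scalar_curvature\<close> is a definite description over all orthonormal frames
  near a point, so one convenient frame is not enough: some frame must exist, and every frame must
  give the same number. The frame fields are arbitrary smooth fields, hence the curvature has to be
  shown tensorial before it can be contracted pointwise. The derivatives of the fields cancel only
  because second derivatives are symmetric, so this symmetry is established for vector-valued maps.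
  The fibres are not reparametrised by arc length, which would mean leaving the given charts. Each
  fibre metric keeps its coefficient function, half of whose logarithmic derivative is the fibre's
  Christoffel symbol.\<close>

lemma has_real_derivative_along_line:
  fixes f :: "'a::real_normed_vector \<Rightarrow> real"
  assumes "(f has_derivative f') (at (a + s *\<^sub>R u))"
  shows "((\<lambda>s. f (a + s *\<^sub>R u)) has_real_derivative f' u) (at s)"
proof -
  have "((\<lambda>s. f (a + s *\<^sub>R u)) has_derivative (\<lambda>h. f' (h *\<^sub>R u))) (at s)"
    by (rule has_derivative_compose[where f = "\<lambda>s. a + s *\<^sub>R u" and g = f, OF _ assms])
      (auto intro!: derivative_eq_intros)
  moreover have "f' (h *\<^sub>R u) = f' u * h" for h
    using linear_scale[OF has_derivative_linear[OF assms]] by simp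
  ultimately show ?thesis by (simp add: has_field_derivative_def)
qed

text \<open>Two applications of the mean value theorem. The second difference is the increment over
  \<open>[0, \<epsilon>]\<close> of \<open>h\<close>, the difference of \<open>f\<close> along two
  parallel segments in direction \<open>u\<close>; the derivative of \<open>h\<close> is in turn an
  increment of \<open>f' y u\<close> in direction \<open>v\<close>.\<close>

lemma second_difference_mvt:
  fixes f :: "'a::real_normed_vector \<Rightarrow> real"
  assumes "\<epsilon> > 0"
    and W: "\<And>s r. 0 \<le> s \<Longrightarrow> s \<le> \<epsilon> \<Longrightarrow> 0 \<le> r \<Longrightarrow> r \<le> \<epsilon> \<Longrightarrow> x + s *\<^sub>R u + r *\<^sub>R v \<in> W"
    and f: "\<And>y. y \<in> W \<Longrightarrow> (f has_derivative f' y) (at y)"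
    and f': "\<And>y. y \<in> W \<Longrightarrow> ((\<lambda>y. f' y u) has_derivative f'' y) (at y)"
  shows "\<exists>s r. 0 < s \<and> s < \<epsilon> \<and> 0 < r \<and> r < \<epsilon> \<and>
    f (x + \<epsilon> *\<^sub>R u + \<epsilon> *\<^sub>R v) - f (x + \<epsilon> *\<^sub>R u) - f (x + \<epsilon> *\<^sub>R v) + f x
      = \<epsilon> * (\<epsilon> * f'' (x + s *\<^sub>R u + r *\<^sub>R v) v)"
proof -
  define h where "h s = f ((x + \<epsilon> *\<^sub>R v) + s *\<^sub>R u) - f (x + s *\<^sub>R u)" for s
  define h' where "h' s = f' ((x + \<epsilon> *\<^sub>R v) + s *\<^sub>R u) u - f' (x + s *\<^sub>R u) u" for s
  have "(h has_real_derivative h' s) (at s)" if "0 \<le> s" "s \<le> \<epsilon>" for s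
    unfolding h_def h'_def
    using W[of s \<epsilon>] W[of s 0] that \<open>\<epsilon> > 0\<close>
    by (intro DERIV_diff has_real_derivative_along_line f) (simp_all add: algebra_simps)
  from MVT2[OF \<open>\<epsilon> > 0\<close> this] obtain s where s: "0 < s" "s < \<epsilon>" "h \<epsilon> - h 0 = \<epsilon> * h' s"
    by auto
  have "((\<lambda>r. f' ((x + s *\<^sub>R u) + r *\<^sub>R v) u) has_real_derivative
      f'' ((x + s *\<^sub>R u) + r *\<^sub>R v) v) (at r)" if "0 \<le> r" "r \<le> \<epsilon>" for r
    using W[of s r] s that
    by (intro has_real_derivative_along_line[of "\<lambda>y. f' y u"] f') simp_all
  from MVT2[OF \<open>\<epsilon> > 0\<close> this] obtain r where r: "0 < r" "r < \<epsilon>"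
    "f' (x + s *\<^sub>R u + \<epsilon> *\<^sub>R v) u - f' (x + s *\<^sub>R u) u = \<epsilon> * f'' (x + s *\<^sub>R u + r *\<^sub>R v) v"
    by auto
  have "h' s = \<epsilon> * f'' (x + s *\<^sub>R u + r *\<^sub>R v) v"
    using r(3) by (simp add: h'_def algebra_simps)
  moreover have "h \<epsilon> - h 0 =
      f (x + \<epsilon> *\<^sub>R u + \<epsilon> *\<^sub>R v) - f (x + \<epsilon> *\<^sub>R u) - f (x + \<epsilon> *\<^sub>R v) + f x"
    by (simp add: h_def algebra_simps)
  ultimately show ?thesis using s r(1,2) by metis
qed

text \<open>The second difference over a parallelogram is symmetric in \<open>u\<close> and
  \<open>v\<close>, and it equals \<open>\<epsilon>\<close> squared times either mixed derivative,
  taken at two nearby points. Continuity keeps both values within half the supposed gap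
  \<open>\<bar>f'' u x v - f'' v x u\<bar>\<close>, a contradiction.\<close>

lemma second_derivative_symmetric_real:
  fixes f :: "'a::real_normed_vector \<Rightarrow> real"
  assumes W: "open W" "x \<in> W"
    and f: "\<And>y. y \<in> W \<Longrightarrow> (f has_derivative f' y) (at y)"
    and f': "\<And>y v. y \<in> W \<Longrightarrow> ((\<lambda>y. f' y v) has_derivative f'' v y) (at y)"
    and cont: "\<And>u v. continuous_on W (\<lambda>y. f'' u y v)"
  shows "f'' u x v = f'' v x u"
proof (rule ccontr)
  assume neq: "f'' u x v \<noteq> f'' v x u"
  define e where "e = \<bar>f'' u x v - f'' v x u\<bar> / 2"
  have "e > 0" using neq by (simp add: e_def)
  have "\<forall>\<^sub>F y in at x. y \<in> W" using W by (rule eventually_at_in_open')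
  moreover have "\<forall>\<^sub>F y in at x. dist (f'' u y v) (f'' u x v) < e"
    and "\<forall>\<^sub>F y in at x. dist (f'' v y u) (f'' v x u) < e"
    using cont W \<open>e > 0\<close> by (auto simp: continuous_on_eq_continuous_at isCont_def intro: tendstoD)
  ultimately have "\<forall>\<^sub>F y in at x. y \<in> W \<and> dist (f'' u y v) (f'' u x v) < e
      \<and> dist (f'' v y u) (f'' v x u) < e"
    by eventually_elim simp
  then obtain d where "d > 0" and d': "\<And>y. y \<noteq> x \<Longrightarrow> dist y x < d \<Longrightarrow>
      y \<in> W \<and> dist (f'' u y v) (f'' u x v) < e \<and> dist (f'' v y u) (f'' v x u) < e"
    by (auto simp: eventually_at)
  have d: "y \<in> W \<and> dist (f'' u y v) (f'' u x v) < e \<and> dist (f'' v y u) (f'' v x u) < e"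
    if "dist y x < d" for y
    using d'[OF _ that] W \<open>e > 0\<close> by (cases "y = x") auto
  \<comment> \<open>Small enough for the whole parallelogram to lie in the ball of radius
    \<open>d\<close>; the summand 1 keeps the denominator positive when \<open>u\<close> and
    \<open>v\<close> vanish.\<close>
  define \<epsilon> where "\<epsilon> = d / (norm u + norm v + 1)"
  have "\<epsilon> > 0" using \<open>d > 0\<close> by (simp add: \<epsilon>_def add_nonneg_pos)
  have near: "dist (x + s *\<^sub>R u + r *\<^sub>R v) x < d" if "0 \<le> s" "s \<le> \<epsilon>" "0 \<le> r" "r \<le> \<epsilon>" for s r
  proof -
    have "dist (x + s *\<^sub>R u + r *\<^sub>R v) x \<le> s * norm u + r * norm v"
      using norm_triangle_ineq[of "s *\<^sub>R u" "r *\<^sub>R v"] that by (simp add: dist_norm)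
    also have "\<dots> \<le> \<epsilon> * norm u + \<epsilon> * norm v"
      using that by (intro add_mono mult_right_mono) simp_all
    also have "\<dots> < \<epsilon> * (norm u + norm v + 1)"
      using \<open>\<epsilon> > 0\<close> by (simp add: distrib_left)
    also have "\<dots> = d" by (simp add: \<epsilon>_def add_nonneg_pos less_imp_neq[symmetric])
    finally show ?thesis .
  qed
  have near': "dist (x + s *\<^sub>R v + r *\<^sub>R u) x < d" if "0 \<le> s" "s \<le> \<epsilon>" "0 \<le> r" "r \<le> \<epsilon>" for s r
    using near[of r s] that by (simp add: algebra_simps)
  obtain s r where 1: "0 < s" "s < \<epsilon>" "0 < r" "r < \<epsilon>"
    "f (x + \<epsilon> *\<^sub>R u + \<epsilon> *\<^sub>R v) - f (x + \<epsilon> *\<^sub>R u) - f (x + \<epsilon> *\<^sub>R v) + f x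
      = \<epsilon> * (\<epsilon> * f'' u (x + s *\<^sub>R u + r *\<^sub>R v) v)"
    using second_difference_mvt[OF \<open>\<epsilon> > 0\<close> _ f f', where W = W and u = u and v = v and x = x]
      near d by blast
  obtain s' r' where 2: "0 < s'" "s' < \<epsilon>" "0 < r'" "r' < \<epsilon>"
    "f (x + \<epsilon> *\<^sub>R v + \<epsilon> *\<^sub>R u) - f (x + \<epsilon> *\<^sub>R v) - f (x + \<epsilon> *\<^sub>R u) + f x
      = \<epsilon> * (\<epsilon> * f'' v (x + s' *\<^sub>R v + r' *\<^sub>R u) u)"
    using second_difference_mvt[OF \<open>\<epsilon> > 0\<close> _ f f', where W = W and u = v and v = u and x = x]
      near' d by blast
  have "\<epsilon> * (\<epsilon> * f'' u (x + s *\<^sub>R u + r *\<^sub>R v) v) = \<epsilon> * (\<epsilon> * f'' v (x + s' *\<^sub>R v + r' *\<^sub>R u) u)"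
    unfolding 1(5)[symmetric] 2(5)[symmetric] by (simp add: algebra_simps)
  then have "f'' u (x + s *\<^sub>R u + r *\<^sub>R v) v = f'' v (x + s' *\<^sub>R v + r' *\<^sub>R u) u"
    using \<open>\<epsilon> > 0\<close> by simp
  moreover have "dist (f'' u (x + s *\<^sub>R u + r *\<^sub>R v) v) (f'' u x v) < e"
    using d[OF near[of s r]] 1 by simp
  moreover have "dist (f'' v (x + s' *\<^sub>R v + r' *\<^sub>R u) u) (f'' v x u) < e"
    using d[OF near'[of s' r']] 2 by simp
  ultimately show False by (simp add: e_def dist_real_def field_simps abs_if split: if_splits)
qed

lemma second_derivative_symmetric:
  fixes f :: "'a::real_normed_vector \<Rightarrow> 'b::euclidean_space"
  assumes W: "open W" "x \<in> W"
    and f: "\<And>y. y \<in> W \<Longrightarrow> (f has_derivative f' y) (at y)"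
    and f': "\<And>y v. y \<in> W \<Longrightarrow> ((\<lambda>y. f' y v) has_derivative f'' v y) (at y)"
    and cont: "\<And>u v. continuous_on W (\<lambda>y. f'' u y v)"
  shows "f'' u x v = f'' v x u"
proof (rule euclidean_eqI)
  fix b :: 'b
  show "f'' u x v \<bullet> b = f'' v x u \<bullet> b"
    by (rule second_derivative_symmetric_real[OF W, where f = "\<lambda>y. f y \<bullet> b"
          and f' = "\<lambda>y v. f' y v \<bullet> b" and f'' = "\<lambda>v y u. f'' v y u \<bullet> b"])
       (auto intro!: has_derivative_inner_left f f' continuous_intros cont)
qed

text \<open>A Leibniz rule for evaluating a field of linear maps at a moving vector.
  Differentiability is given only for each fixed argument; as \<open>'e\<close> has finite
  dimension, expanding the argument in \<open>Basis\<close> turns the evaluation into a finite sum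
  of products.\<close>

lemma has_derivative_apply_linear:
  fixes F :: "'a::real_normed_vector \<Rightarrow> 'e::euclidean_space \<Rightarrow> 'b::real_normed_vector"
  assumes W: "open W" "x \<in> W"
    and lin: "\<And>y. y \<in> W \<Longrightarrow> linear (F y)"
    and F: "\<And>v. ((\<lambda>y. F y v) has_derivative F' v) (at x)"
    and Y: "(Y has_derivative Y') (at x)"
  shows "((\<lambda>y. F y (Y y)) has_derivative (\<lambda>h. F' (Y x) h + F x (Y' h))) (at x)"
proof -
  have expand: "(\<Sum>e\<in>Basis. (v \<bullet> e) *\<^sub>R F y e) = F y v" if "y \<in> W" for y v
    using linear_sum[OF lin[OF that], of "\<lambda>e. (v \<bullet> e) *\<^sub>R e" Basis]
    by (simp add: linear_scale[OF lin[OF that]] euclidean_representation)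
  have "((\<lambda>y. \<Sum>e\<in>Basis. (v \<bullet> e) *\<^sub>R F y e) has_derivative
      (\<lambda>h. \<Sum>e\<in>Basis. (v \<bullet> e) *\<^sub>R F' e h)) (at x)" for v
    by (intro has_derivative_sum has_derivative_scaleR_right F)
  then have "((\<lambda>y. F y v) has_derivative (\<lambda>h. \<Sum>e\<in>Basis. (v \<bullet> e) *\<^sub>R F' e h)) (at x)" for v
    by (rule has_derivative_transform_within_open[OF _ W]) (rule expand)
  \<comment> \<open>\<open>F'\<close> is a separate family for each \<open>v\<close>; that it
    depends linearly on \<open>v\<close> follows from uniqueness of derivatives.\<close>
  from has_derivative_unique[OF F this]
  have F': "F' v h = (\<Sum>e\<in>Basis. (v \<bullet> e) *\<^sub>R F' e h)" for v h by meson
  have "((\<lambda>y. \<Sum>e\<in>Basis. (Y y \<bullet> e) *\<^sub>R F y e) has_derivative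
      (\<lambda>h. \<Sum>e\<in>Basis. (Y x \<bullet> e) *\<^sub>R F' e h + (Y' h \<bullet> e) *\<^sub>R F x e)) (at x)"
    by (intro has_derivative_sum has_derivative_scaleR has_derivative_inner_left F Y)
  then have "((\<lambda>y. \<Sum>e\<in>Basis. (Y y \<bullet> e) *\<^sub>R F y e) has_derivative
      (\<lambda>h. F' (Y x) h + F x (Y' h))) (at x)"
    unfolding sum.distrib expand[OF W(2)] F'[symmetric] .
  then show ?thesis
    by (rule has_derivative_transform_within_open[OF _ W]) (rule expand)
qed

text \<open>Tensoriality. The second derivatives of \<open>Z\<close> cancel by symmetry, the mixed
  terms of \<open>\<Gamma>\<close> with a first derivative of \<open>Z\<close> occur once with each
  sign, and the derivatives of \<open>X\<close> and \<open>Y\<close> are absorbed by the bracket.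
  Only the values of the three fields at \<open>x\<close> survive. \<open>\<Gamma>\<close> may be
  asymmetric in its two vector arguments, so connections with torsion are covered.\<close>

lemma curvature_in_coordinates:
  fixes D :: "'e::euclidean_space local_connection" and \<Gamma> :: "'e \<Rightarrow> 'e \<Rightarrow> 'e \<Rightarrow> 'e"
  assumes W: "open W" "x \<in> W"
    and D: "\<And>X Y y. y \<in> W \<Longrightarrow> D X Y y = frechet_derivative Y (at y) (X y) + \<Gamma> y (X y) (Y y)"
    and bil: "\<And>y. y \<in> W \<Longrightarrow> bilinear (\<Gamma> y)"
    and \<Gamma>: "\<And>u v. ((\<lambda>y. \<Gamma> y u v) has_derivative (\<lambda>h. \<Gamma>' h u v)) (at x)"
    and X: "X differentiable at x" and Y: "Y differentiable at x" and Z: "C_k_on 2 W Z"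
  shows "curvature D X Y Z x = \<Gamma>' (X x) (Y x) (Z x) - \<Gamma>' (Y x) (X x) (Z x)
    + \<Gamma> x (X x) (\<Gamma> x (Y x) (Z x)) - \<Gamma> x (Y x) (\<Gamma> x (X x) (Z x))"
proof -
  define Z' where "Z' y = frechet_derivative Z (at y)" for y
  define Z'' where "Z'' v y = frechet_derivative (\<lambda>y. Z' y v) (at y)" for v y
  have Zd: "(Z has_derivative Z' y) (at y)"
    and Z'd: "((\<lambda>y. Z' y v) has_derivative Z'' v y) (at y)" if "y \<in> W" for y v
    using Z that by (simp_all add: Z'_def Z''_def numeral_2_eq_2 flip: frechet_derivative_works)
  have "continuous_on W (\<lambda>y. Z'' u y v)" for u v
    using Z by (simp add: Z'_def Z''_def numeral_2_eq_2)
  from second_derivative_symmetric[OF W Zd Z'd this]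
  have sym: "Z'' u x v = Z'' v x u" for u v .
  note lin_simps = bilinear_ladd[OF bil[OF W(2)]] bilinear_radd[OF bil[OF W(2)]]
    bilinear_lsub[OF bil[OF W(2)]] linear_diff[OF has_derivative_linear[OF Zd[OF W(2)]]]
  have DD: "D A (D B Z) x = Z'' (B x) x (A x) + Z' x (B' (A x)) + \<Gamma>' (A x) (B x) (Z x)
      + \<Gamma> x (B' (A x)) (Z x) + \<Gamma> x (B x) (Z' x (A x)) + \<Gamma> x (A x) (Z' x (B x))
      + \<Gamma> x (A x) (\<Gamma> x (B x) (Z x))"
    if B: "(B has_derivative B') (at x)" for A B B'
  proof -
    have lin: "linear (\<Gamma> y (B y))" if "y \<in> W" for y
      using bil[OF that] by (simp add: bilinear_def)
    have "((\<lambda>y. Z' y (B y)) has_derivative (\<lambda>h. Z'' (B x) x h + Z' x (B' h))) (at x)"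
      by (rule has_derivative_apply_linear[OF W has_derivative_linear[OF Zd] Z'd[OF W(2)] B])
    moreover have "((\<lambda>y. \<Gamma> y (B y) w) has_derivative
        (\<lambda>h. \<Gamma>' h (B x) w + \<Gamma> x (B' h) w)) (at x)" for w
      using bil by (intro has_derivative_apply_linear[OF W _ \<Gamma> B]) (simp add: bilinear_def)
    from has_derivative_apply_linear[OF W lin this Zd[OF W(2)]]
    have "((\<lambda>y. \<Gamma> y (B y) (Z y)) has_derivative
        (\<lambda>h. (\<Gamma>' h (B x) (Z x) + \<Gamma> x (B' h) (Z x)) + \<Gamma> x (B x) (Z' x h))) (at x)" .
    ultimately have "((\<lambda>y. Z' y (B y) + \<Gamma> y (B y) (Z y)) has_derivative
        (\<lambda>h. (Z'' (B x) x h + Z' x (B' h))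
          + ((\<Gamma>' h (B x) (Z x) + \<Gamma> x (B' h) (Z x)) + \<Gamma> x (B x) (Z' x h)))) (at x)"
      by (rule has_derivative_add)
    then have "(D B Z has_derivative
        (\<lambda>h. (Z'' (B x) x h + Z' x (B' h))
          + ((\<Gamma>' h (B x) (Z x) + \<Gamma> x (B' h) (Z x)) + \<Gamma> x (B x) (Z' x h)))) (at x)"
      by (rule has_derivative_transform_within_open[OF _ W]) (simp add: D Z'_def)
    from frechet_derivative_at[OF this, symmetric] show ?thesis
      by (simp add: D[OF W(2)] lin_simps Z'_def)
  qed
  have X': "(X has_derivative frechet_derivative X (at x)) (at x)"
    and Y': "(Y has_derivative frechet_derivative Y (at x)) (at x)"
    using X Y by (simp_all flip: frechet_derivative_works)
  have DB: "D (bracket X Y) Z x = Z' x (bracket X Y x) + \<Gamma> x (bracket X Y x) (Z x)"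
    by (simp add: D[OF W(2)] Z'_def)
  show ?thesis
    unfolding curvature_def DD[OF X'] DD[OF Y'] DB
    by (simp add: bracket_def lin_simps sym[of "X x" "Y x"])
qed

section \<open>Functions of class \<open>C\<^sup>k\<close>\<close>

lemma C_k_on_cong:
  assumes "open S" "\<And>x. x \<in> S \<Longrightarrow> f x = h x" "C_k_on k S f"
  shows "C_k_on k S h"
  using assms(2,3)
proof (induction k arbitrary: f h)
  case 0
  then show ?case by (simp cong: continuous_on_cong)
next
  case (Suc k)
  have h: "(h has_derivative frechet_derivative f (at x)) (at x)" if "x \<in> S" for x
  proof (rule has_derivative_transform_within_open[OF _ \<open>open S\<close> that Suc.prems(1)])
    show "(f has_derivative frechet_derivative f (at x)) (at x)"
      using Suc.prems(2) that by (simp flip: frechet_derivative_works)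
  qed
  have "C_k_on k S (\<lambda>x. frechet_derivative h (at x) v)" for v
  proof (rule Suc.IH)
    show "C_k_on k S (\<lambda>x. frechet_derivative f (at x) v)" using Suc.prems(2) by simp
  qed (simp add: frechet_derivative_at[OF h])
  then show ?case using h by (auto simp: differentiable_def)
qed

text \<open>Lets a derivative be supplied in closed form instead of as
  \<open>frechet_derivative\<close>; openness of \<open>S\<close> makes the two interchangeable at
  the next level.\<close>

lemma C_k_on_SucI:
  assumes "open S" and f: "\<And>x. x \<in> S \<Longrightarrow> (f has_derivative f' x) (at x)"
    and f': "\<And>v. C_k_on k S (\<lambda>x. f' x v)"
  shows "C_k_on (Suc k) S f"
proof -
  have "C_k_on k S (\<lambda>x. frechet_derivative f (at x) v)" for v
    by (rule C_k_on_cong[OF \<open>open S\<close> _ f']) (simp add: frechet_derivative_at[OF f])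
  then show ?thesis using f by (auto simp: differentiable_def)
qed

lemma C_k_on_SucD:
  assumes "C_k_on (Suc k) S f" "x \<in> S"
  shows "(f has_derivative frechet_derivative f (at x)) (at x)"
  using assms by (simp flip: frechet_derivative_works)

lemma C_k_on_Suc_imp: "C_k_on (Suc k) S f \<Longrightarrow> C_k_on k S f"
  by (induction k arbitrary: f)
    (auto simp: continuous_on_eq_continuous_within
      intro: differentiable_imp_continuous_within differentiable_at_withinI)

lemma C_k_on_const:
  assumes "open S"
  shows "C_k_on k S (\<lambda>x. c)"
proof (induction k arbitrary: c)
  case (Suc k)
  then show ?case
    by (intro C_k_on_SucI[OF assms, where f' = "\<lambda>x v. 0"]) auto
qed simp

lemma C_k_on_add:
  assumes "open S" "C_k_on k S f" "C_k_on k S h"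
  shows "C_k_on k S (\<lambda>x. f x + h x)"
  using assms(2,3)
proof (induction k arbitrary: f h)
  case 0
  then show ?case by (auto intro: continuous_intros)
next
  case (Suc k)
  have "((\<lambda>x. f x + h x) has_derivative
      (\<lambda>v. frechet_derivative f (at x) v + frechet_derivative h (at x) v)) (at x)" if "x \<in> S" for x
    by (intro has_derivative_add C_k_on_SucD[OF Suc.prems(1) that] C_k_on_SucD[OF Suc.prems(2) that])
  then show ?case
    by (rule C_k_on_SucI[OF \<open>open S\<close>]) (use Suc in auto)
qed

lemma C_k_on_mult:
  fixes f h :: "'a::euclidean_space \<Rightarrow> real"
  assumes "open S" "C_k_on k S f" "C_k_on k S h"
  shows "C_k_on k S (\<lambda>x. f x * h x)"
  using assms(2,3)
proof (induction k arbitrary: f h)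
  case 0
  then show ?case by (auto intro: continuous_intros)
next
  case (Suc k)
  have "((\<lambda>x. f x * h x) has_derivative
      (\<lambda>v. f x * frechet_derivative h (at x) v + frechet_derivative f (at x) v * h x)) (at x)"
    if "x \<in> S" for x
    by (intro has_derivative_mult C_k_on_SucD[OF Suc.prems(1) that] C_k_on_SucD[OF Suc.prems(2) that])
  then show ?case
    by (rule C_k_on_SucI[OF \<open>open S\<close>])
       (use Suc C_k_on_Suc_imp[OF Suc.prems(1)] C_k_on_Suc_imp[OF Suc.prems(2)] in
         \<open>auto intro!: C_k_on_add[OF \<open>open S\<close>]\<close>)
qed

text \<open>The exponent has to vary in the induction, because differentiation replaces
  \<open>r\<close> by \<open>r - 1\<close>. Positivity of \<open>f\<close> keeps every such power
  differentiable.\<close>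

lemma C_k_on_powr:
  fixes f :: "'a::euclidean_space \<Rightarrow> real"
  assumes "open S" "\<And>x. x \<in> S \<Longrightarrow> f x > 0" "C_k_on k S f"
  shows "C_k_on k S (\<lambda>x. f x powr r)"
  using assms(3)
proof (induction k arbitrary: r)
  case 0
  then show ?case using assms(2) by (fastforce intro: continuous_intros)
next
  case (Suc k)
  have "((\<lambda>x. f x powr r) has_derivative
      (\<lambda>v. frechet_derivative f (at x) v * (r * f x powr (r - 1)))) (at x)" if "x \<in> S" for x
    by (intro DERIV_compose_FDERIV has_real_derivative_powr C_k_on_SucD[OF Suc.prems that]
        assms(2) that)
  then show ?case
    by (rule C_k_on_SucI[OF \<open>open S\<close>])
       (use Suc C_k_on_Suc_imp[OF Suc.prems] in
         \<open>auto intro!: C_k_on_mult[OF \<open>open S\<close>] C_k_on_const[OF \<open>open S\<close>]\<close>)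
qed

text \<open>Used with coordinate projections, to regard a function of one coordinate as a function
  on the product.\<close>

lemma C_k_on_compose_linear:
  fixes L :: "'a::euclidean_space \<Rightarrow> 'b::euclidean_space"
  assumes "open T" and L: "bounded_linear L" and "L ` T \<subseteq> S" and "C_k_on k S f"
  shows "C_k_on k T (\<lambda>x. f (L x))"
  using assms(4)
proof (induction k arbitrary: f)
  case 0
  then show ?case
    using continuous_on_compose2[OF _ linear_continuous_on[OF L] \<open>L ` T \<subseteq> S\<close>] by simp
next
  case (Suc k)
  have "((\<lambda>x. f (L x)) has_derivative (\<lambda>v. frechet_derivative f (at (L x)) (L v))) (at x)"
    if "x \<in> T" for x
    using that \<open>L ` T \<subseteq> S\<close>
    by (intro has_derivative_compose[OF bounded_linear_imp_has_derivative[OF L]]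
        C_k_on_SucD[OF Suc.prems]) auto
  then show ?case
    by (rule C_k_on_SucI[OF \<open>open T\<close>]) (use Suc in auto)
qed

lemma C_k_on_linear_compose:
  assumes "open S" and L: "bounded_linear L" and "C_k_on k S f"
  shows "C_k_on k S (\<lambda>x. L (f x))"
  using assms(3)
proof (induction k arbitrary: f)
  case 0
  then show ?case by (simp add: bounded_linear.continuous_on[OF L])
next
  case (Suc k)
  have "((\<lambda>x. L (f x)) has_derivative (\<lambda>v. L (frechet_derivative f (at x) v))) (at x)"
    if "x \<in> S" for x
    by (rule bounded_linear.has_derivative[OF L C_k_on_SucD[OF Suc.prems that]])
  then show ?case
    by (rule C_k_on_SucI[OF \<open>open S\<close>]) (use Suc in auto)
qed

lemma smooth_on_differentiable: "smooth_on S f \<Longrightarrow> x \<in> S \<Longrightarrow> f differentiable at x"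
  unfolding smooth_on_def using C_k_on.simps(2) by blast

lemma smooth_on_real_derivative:
  fixes f :: "real \<Rightarrow> real"
  assumes "open S" "smooth_on S f"
  obtains f' where "smooth_on S f'" "\<And>x. x \<in> S \<Longrightarrow> (f has_real_derivative f' x) (at x)"
proof
  define f' where "f' x = frechet_derivative f (at x) 1" for x
  show "smooth_on S f'"
    unfolding smooth_on_def f'_def
  proof
    fix k
    have "C_k_on (Suc k) S f" using assms(2) by (simp only: smooth_on_def)
    then show "C_k_on k S (\<lambda>x. frechet_derivative f (at x) 1)" by simp
  qed
  show "(f has_real_derivative f' x) (at x)" if "x \<in> S" for x
  proof -
    have d: "(f has_derivative frechet_derivative f (at x)) (at x)"
      using smooth_on_differentiable[OF assms(2) that] by (simp flip: frechet_derivative_works)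
    have "frechet_derivative f (at x) h = f' x * h" for h
      using linear_scale[OF has_derivative_linear[OF d], of h 1] by (simp add: f'_def)
    then have "frechet_derivative f (at x) = (*) (f' x)" by auto
    with d show ?thesis by (simp add: has_field_derivative_def)
  qed
qed

section \<open>Traces in orthonormal frames\<close>

text \<open>Pairing a linear combination of the \<open>E j\<close> with \<open>E k\<close> returns
  the \<open>k\<close>-th coefficient up to the sign \<open>b (E k) (E k)\<close>. Hence the
  \<open>DIM('e)\<close> vectors are independent, so they span the space, and the same pairing reads
  off the coefficients of \<open>w\<close>.\<close>

lemma orthonormal_expansion:
  fixes b :: "'e::euclidean_space \<Rightarrow> 'e \<Rightarrow> real" and E :: "nat \<Rightarrow> 'e"
  assumes bil: "bilinear b"
    and orth: "\<And>j k. j < DIM('e) \<Longrightarrow> k < DIM('e) \<Longrightarrow> j \<noteq> k \<Longrightarrow> b (E j) (E k) = 0"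
    and unit: "\<And>k. k < DIM('e) \<Longrightarrow> b (E k) (E k) \<in> {1, -1}"
  shows "w = (\<Sum>k<DIM('e). (b (E k) (E k) * b w (E k)) *\<^sub>R E k)"
proof -
  have unit': "b (E k) (E k) * b (E k) (E k) = 1" if "k < DIM('e)" for k
    using unit[OF that] by auto
  have lin: "linear (\<lambda>v. b v (E k))" for k using bil by (simp add: bilinear_def)
  have coeff: "b (\<Sum>j<DIM('e). c j *\<^sub>R E j) (E k) = c k * b (E k) (E k)" if "k < DIM('e)" for c k
  proof -
    have "b (\<Sum>j<DIM('e). c j *\<^sub>R E j) (E k) = (\<Sum>j<DIM('e). c j * b (E j) (E k))"
      by (simp add: linear_sum[OF lin] linear_scale[OF lin])
    also have "\<dots> = (\<Sum>j<DIM('e). if j = k then c k * b (E k) (E k) else 0)"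
      by (rule sum.cong) (use orth that in auto)
    finally show ?thesis using that by simp
  qed
  have inj: "inj_on E {..<DIM('e)}"
    using orth unit by (intro inj_onI) (metis insert_iff lessThan_iff singletonD zero_neq_neg_one zero_neq_one)
  have "independent (E ` {..<DIM('e)})"
  proof (rule independent_if_scalars_zero)
    fix f v assume 0: "(\<Sum>x\<in>E ` {..<DIM('e)}. f x *\<^sub>R x) = 0" and "v \<in> E ` {..<DIM('e)}"
    then obtain k where k: "k < DIM('e)" "v = E k" by auto
    from 0 have "(\<Sum>j<DIM('e). f (E j) *\<^sub>R E j) = 0" by (simp add: sum.reindex[OF inj])
    with coeff[OF k(1), of "\<lambda>j. f (E j)"] have "f v * b (E k) (E k) = 0"
      using linear_0[OF lin] k by simp
    then show "f v = 0" using unit'[OF k(1)] by auto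
  qed simp
  then have "w \<in> span (E ` {..<DIM('e)})"
    using card_ge_dim_independent[of "E ` {..<DIM('e)}" UNIV] by (auto simp: card_image[OF inj])
  then obtain c where c: "w = (\<Sum>v\<in>E ` {..<DIM('e)}. c v *\<^sub>R v)"
    by (auto simp: span_finite)
  then have c': "w = (\<Sum>j<DIM('e). c (E j) *\<^sub>R E j)"
    by (simp add: sum.reindex[OF inj])
  have "b (E k) (E k) * b w (E k) = c (E k)" if "k < DIM('e)" for k
    using coeff[OF that, of "\<lambda>j. c (E j)"] unit'[OF that] unfolding c'[symmetric]
    by (metis mult.assoc mult.commute mult_1)
  then show ?thesis using c' by simp
qed

text \<open>Both sides contract \<open>T\<close> with the inverse of \<open>b\<close>, so the trace does not depend on the frame.\<close>

lemma orthonormal_trace: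
  fixes b T :: "'e::euclidean_space \<Rightarrow> 'e \<Rightarrow> real" and E :: "nat \<Rightarrow> 'e"
  assumes bil: "bilinear b" and sym: "\<And>v w. b v w = b w v" and T: "bilinear T"
    and orth: "\<And>j k. j < DIM('e) \<Longrightarrow> k < DIM('e) \<Longrightarrow> j \<noteq> k \<Longrightarrow> b (E j) (E k) = 0"
    and unit: "\<And>k. k < DIM('e) \<Longrightarrow> b (E k) (E k) \<in> {1, -1}"
    and diag: "\<And>d e. d \<in> Basis \<Longrightarrow> e \<in> Basis \<Longrightarrow> d \<noteq> e \<Longrightarrow> b d e = 0"
    and nz: "\<And>e. e \<in> Basis \<Longrightarrow> b e e \<noteq> 0"
  shows "(\<Sum>k<DIM('e). b (E k) (E k) * T (E k) (E k)) = (\<Sum>e\<in>Basis. T e e / b e e)"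
proof -
  have linb: "linear (\<lambda>v. b v e)" and linT: "linear (\<lambda>v. T v u)" "linear (T u)" for e u
    using bil T by (simp_all add: bilinear_def)
  \<comment> \<open>The standard basis is orthogonal for \<open>b\<close>, so the Euclidean
    coordinates are quotients of values of \<open>b\<close>.\<close>
  have coord: "v \<bullet> e = b e v / b e e" if "e \<in> Basis" for v e
  proof -
    have "b (\<Sum>d\<in>Basis. (v \<bullet> d) *\<^sub>R d) e = (\<Sum>d\<in>Basis. (v \<bullet> d) * b d e)"
      by (simp add: linear_sum[OF linb] linear_scale[OF linb])
    also have "\<dots> = (\<Sum>d\<in>Basis. if d = e then (v \<bullet> e) * b e e else 0)"
      by (rule sum.cong) (use diag that in auto)
    finally show ?thesis using that nz by (simp add: euclidean_representation sym[of v])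
  qed
  \<comment> \<open>Only the first argument is expanded in the coordinate basis. The second remains
    \<open>E k\<close>, so that the sum over \<open>k\<close> later reassembles the basis vector
    \<open>e\<close> there by \<open>orthonormal_expansion\<close>.\<close>
  have "T u u = (\<Sum>e\<in>Basis. (u \<bullet> e) * T e u)" for u
  proof -
    have "T (\<Sum>e\<in>Basis. (u \<bullet> e) *\<^sub>R e) u = (\<Sum>e\<in>Basis. (u \<bullet> e) * T e u)"
      by (simp add: linear_sum[OF linT(1)] linear_scale[OF linT(1)])
    then show ?thesis by (simp add: euclidean_representation)
  qed
  then have "(\<Sum>k<DIM('e). b (E k) (E k) * T (E k) (E k))
      = (\<Sum>k<DIM('e). \<Sum>e\<in>Basis. b (E k) (E k) * ((b e (E k) / b e e) * T e (E k)))"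
    by (simp add: sum_distrib_left coord)
  also have "\<dots> = (\<Sum>e\<in>Basis. \<Sum>k<DIM('e). b (E k) (E k) * b e (E k) * T e (E k) / b e e)"
    by (subst sum.swap) (simp add: mult.assoc)
  also have "\<dots> = (\<Sum>e\<in>Basis. T e e / b e e)"
  proof (rule sum.cong)
    fix e :: 'e
    have "T e (\<Sum>k<DIM('e). (b (E k) (E k) * b e (E k)) *\<^sub>R E k)
        = (\<Sum>k<DIM('e). b (E k) (E k) * b e (E k) * T e (E k))"
      by (simp add: linear_sum[OF linT(2)] linear_scale[OF linT(2)])
    then show "(\<Sum>k<DIM('e). b (E k) (E k) * b e (E k) * T e (E k) / b e e) = T e e / b e e"
      using orthonormal_expansion[OF bil orth unit, where w = e] by (simp flip: sum_divide_distrib)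
  qed simp
  finally show ?thesis .
qed

section \<open>Lorentzian warped products with three one-dimensional fibres\<close>

abbreviation co1 :: "'a \<times> 'b \<times> 'c \<times> 'd \<Rightarrow> 'b" where "co1 v \<equiv> fst (snd v)"
abbreviation co2 :: "'a \<times> 'b \<times> 'c \<times> 'd \<Rightarrow> 'c" where "co2 v \<equiv> fst (snd (snd v))"
abbreviation co3 :: "'a \<times> 'b \<times> 'c \<times> 'd \<Rightarrow> 'd" where "co3 v \<equiv> snd (snd (snd v))"

text \<open>The functions \<open>A1\<close>, \<open>A2\<close>, \<open>A3\<close> are the squared
  warping factors and \<open>H1\<close>, \<open>H2\<close>, \<open>H3\<close> half their logarithmic
  derivatives, the expansion rates of the fibres. Likewise \<open>h1\<close>, \<open>h2\<close>,
  \<open>h3\<close> are the fibre metric coefficients, and \<open>k1\<close>, \<open>k2\<close>,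
  \<open>k3\<close> are the Christoffel symbols of the fibres. Writing derivatives as multiples such
  as \<open>2 * H1 t * A1 t\<close> keeps divisions out of the connection coefficients.\<close>

locale warped_lines =
  fixes I U1 U2 U3 :: "real set" and A1 A2 A3 H1 H2 H3 H1' H2' H3' :: "real \<Rightarrow> real"
    and h1 h2 h3 k1 k2 k3 k1' k2' k3' :: "real \<Rightarrow> real"
    and g :: "(real \<times> real \<times> real \<times> real) local_metric"
  assumes open_base: "open I" and open_fibre: "open U1" "open U2" "open U3"
    and smooth_base: "smooth_on I A1" "smooth_on I A2" "smooth_on I A3"
    and smooth_fibre: "smooth_on U1 h1" "smooth_on U2 h2" "smooth_on U3 h3"
    and pos_base: "\<And>t. t \<in> I \<Longrightarrow> A1 t > 0" "\<And>t. t \<in> I \<Longrightarrow> A2 t > 0" "\<And>t. t \<in> I \<Longrightarrow> A3 t > 0"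
    and pos_fibre: "\<And>s. s \<in> U1 \<Longrightarrow> h1 s > 0" "\<And>s. s \<in> U2 \<Longrightarrow> h2 s > 0" "\<And>s. s \<in> U3 \<Longrightarrow> h3 s > 0"
    and deriv_A: "\<And>t. t \<in> I \<Longrightarrow> (A1 has_real_derivative 2 * H1 t * A1 t) (at t)"
      "\<And>t. t \<in> I \<Longrightarrow> (A2 has_real_derivative 2 * H2 t * A2 t) (at t)"
      "\<And>t. t \<in> I \<Longrightarrow> (A3 has_real_derivative 2 * H3 t * A3 t) (at t)"
    and deriv_H: "\<And>t. t \<in> I \<Longrightarrow> (H1 has_real_derivative H1' t) (at t)"
      "\<And>t. t \<in> I \<Longrightarrow> (H2 has_real_derivative H2' t) (at t)"
      "\<And>t. t \<in> I \<Longrightarrow> (H3 has_real_derivative H3' t) (at t)"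
    and deriv_h: "\<And>s. s \<in> U1 \<Longrightarrow> (h1 has_real_derivative 2 * k1 s * h1 s) (at s)"
      "\<And>s. s \<in> U2 \<Longrightarrow> (h2 has_real_derivative 2 * k2 s * h2 s) (at s)"
      "\<And>s. s \<in> U3 \<Longrightarrow> (h3 has_real_derivative 2 * k3 s * h3 s) (at s)"
    and deriv_k: "\<And>s. s \<in> U1 \<Longrightarrow> (k1 has_real_derivative k1' s) (at s)"
      "\<And>s. s \<in> U2 \<Longrightarrow> (k2 has_real_derivative k2' s) (at s)"
      "\<And>s. s \<in> U3 \<Longrightarrow> (k3 has_real_derivative k3' s) (at s)"
    and metric: "\<And>y v w. y \<in> I \<times> U1 \<times> U2 \<times> U3 \<Longrightarrow> g y v w = - (fst v * fst w)
      + A1 (fst y) * h1 (co1 y) * (co1 v * co1 w) + A2 (fst y) * h2 (co2 y) * (co2 v * co2 w)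
      + A3 (fst y) * h3 (co3 y) * (co3 v * co3 w)"
begin

definition U :: "(real \<times> real \<times> real \<times> real) set" where "U = I \<times> U1 \<times> U2 \<times> U3"

definition G1 where "G1 y = A1 (fst y) * h1 (co1 y)" for y :: "real \<times> real \<times> real \<times> real"
definition G2 where "G2 y = A2 (fst y) * h2 (co2 y)" for y :: "real \<times> real \<times> real \<times> real"
definition G3 where "G3 y = A3 (fst y) * h3 (co3 y)" for y :: "real \<times> real \<times> real \<times> real"

text \<open>The coefficients of the quarter-symmetric connection with \<open>lam1 = a\<close> and \<open>lam2 = b\<close>
  (the Christoffel symbols for \<open>a = b = 0\<close>), and below their derivative in the direction \<open>h\<close>,
  which does not involve \<open>a\<close>.\<close>

definition \<Gamma> :: "real \<Rightarrow> real \<Rightarrow> real \<times> real \<times> real \<times> real \<Rightarrow>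
    real \<times> real \<times> real \<times> real \<Rightarrow> real \<times> real \<times> real \<times> real \<Rightarrow> real \<times> real \<times> real \<times> real" where
  "\<Gamma> a b y u v =
    ((H1 (fst y) - b) * G1 y * (co1 u * co1 v) + (H2 (fst y) - b) * G2 y * (co2 u * co2 v)
       + (H3 (fst y) - b) * G3 y * (co3 u * co3 v) + (b - a) * (fst u * fst v),
     H1 (fst y) * (fst u * co1 v) + (H1 (fst y) - a) * (co1 u * fst v) + k1 (co1 y) * (co1 u * co1 v),
     H2 (fst y) * (fst u * co2 v) + (H2 (fst y) - a) * (co2 u * fst v) + k2 (co2 y) * (co2 u * co2 v),
     H3 (fst y) * (fst u * co3 v) + (H3 (fst y) - a) * (co3 u * fst v) + k3 (co3 y) * (co3 u * co3 v))"

definition \<Gamma>' :: "real \<Rightarrow> real \<times> real \<times> real \<times> real \<Rightarrow> real \<times> real \<times> real \<times> real \<Rightarrow>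
    real \<times> real \<times> real \<times> real \<Rightarrow> real \<times> real \<times> real \<times> real \<Rightarrow> real \<times> real \<times> real \<times> real" where
  "\<Gamma>' b y h u v =
    ((H1' (fst y) * fst h + (H1 (fst y) - b) * (2 * H1 (fst y) * fst h + 2 * k1 (co1 y) * co1 h))
         * G1 y * (co1 u * co1 v)
       + (H2' (fst y) * fst h + (H2 (fst y) - b) * (2 * H2 (fst y) * fst h + 2 * k2 (co2 y) * co2 h))
         * G2 y * (co2 u * co2 v)
       + (H3' (fst y) * fst h + (H3 (fst y) - b) * (2 * H3 (fst y) * fst h + 2 * k3 (co3 y) * co3 h))
         * G3 y * (co3 u * co3 v),
     H1' (fst y) * fst h * (fst u * co1 v + co1 u * fst v) + k1' (co1 y) * co1 h * (co1 u * co1 v),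
     H2' (fst y) * fst h * (fst u * co2 v + co2 u * fst v) + k2' (co2 y) * co2 h * (co2 u * co2 v),
     H3' (fst y) * fst h * (fst u * co3 v + co3 u * fst v) + k3' (co3 y) * co3 h * (co3 u * co3 v))"

section \<open>The connection coefficients of the warped metric\<close>

lemma open_U: "open U"
  unfolding U_def by (intro open_Times open_base open_fibre)

lemma in_U:
  assumes "y \<in> U"
  shows "fst y \<in> I" "co1 y \<in> U1" "co2 y \<in> U2" "co3 y \<in> U3"
  using assms by (auto simp: U_def)

lemma g_eq: "y \<in> U \<Longrightarrow> g y v w = - (fst v * fst w) + G1 y * (co1 v * co1 w) + G2 y * (co2 v * co2 w)
    + G3 y * (co3 v * co3 w)"
  by (simp add: U_def metric G1_def G2_def G3_def)

lemma G_pos: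
  assumes "y \<in> U"
  shows "G1 y > 0" "G2 y > 0" "G3 y > 0"
  using in_U[OF assms] by (simp_all add: G1_def G2_def G3_def pos_base pos_fibre)


lemma coordinate_derivatives:
  fixes y :: "real \<times> real \<times> real \<times> real"
  shows "(f has_real_derivative d) (at (fst y)) \<Longrightarrow>
      ((\<lambda>y. f (fst y)) has_derivative (\<lambda>u. d * fst u)) (at y)"
    and "(f has_real_derivative d) (at (co1 y)) \<Longrightarrow>
      ((\<lambda>y. f (co1 y)) has_derivative (\<lambda>u. d * co1 u)) (at y)"
    and "(f has_real_derivative d) (at (co2 y)) \<Longrightarrow>
      ((\<lambda>y. f (co2 y)) has_derivative (\<lambda>u. d * co2 u)) (at y)"
    and "(f has_real_derivative d) (at (co3 y)) \<Longrightarrow>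
      ((\<lambda>y. f (co3 y)) has_derivative (\<lambda>u. d * co3 u)) (at y)"
  unfolding mult.commute[of d]
  by (rule DERIV_compose_FDERIV; auto intro!: derivative_eq_intros)+

lemma H_has_derivative:
  assumes "y \<in> U"
  shows "((\<lambda>y. H1 (fst y)) has_derivative (\<lambda>u. H1' (fst y) * fst u)) (at y)"
    "((\<lambda>y. H2 (fst y)) has_derivative (\<lambda>u. H2' (fst y) * fst u)) (at y)"
    "((\<lambda>y. H3 (fst y)) has_derivative (\<lambda>u. H3' (fst y) * fst u)) (at y)"
  using in_U[OF assms] by (auto intro!: coordinate_derivatives deriv_H)

lemma k_has_derivative:
  assumes "y \<in> U"
  shows "((\<lambda>y. k1 (co1 y)) has_derivative (\<lambda>u. k1' (co1 y) * co1 u)) (at y)"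
    "((\<lambda>y. k2 (co2 y)) has_derivative (\<lambda>u. k2' (co2 y) * co2 u)) (at y)"
    "((\<lambda>y. k3 (co3 y)) has_derivative (\<lambda>u. k3' (co3 y) * co3 u)) (at y)"
  using in_U[OF assms] by (auto intro!: coordinate_derivatives deriv_k)

lemma G_has_derivative:
  assumes "y \<in> U"
  shows "(G1 has_derivative (\<lambda>u. (2 * H1 (fst y) * fst u + 2 * k1 (co1 y) * co1 u) * G1 y)) (at y)"
    "(G2 has_derivative (\<lambda>u. (2 * H2 (fst y) * fst u + 2 * k2 (co2 y) * co2 u) * G2 y)) (at y)"
    "(G3 has_derivative (\<lambda>u. (2 * H3 (fst y) * fst u + 2 * k3 (co3 y) * co3 u) * G3 y)) (at y)"
  unfolding G1_def[abs_def] G2_def[abs_def] G3_def[abs_def]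
  using in_U[OF assms]
  by (auto intro!: has_derivative_eq_rhs[OF has_derivative_mult[OF
        coordinate_derivatives(1)[OF deriv_A(1)] coordinate_derivatives(2)[OF deriv_h(1)]]]
      has_derivative_eq_rhs[OF has_derivative_mult[OF
        coordinate_derivatives(1)[OF deriv_A(2)] coordinate_derivatives(3)[OF deriv_h(2)]]]
      has_derivative_eq_rhs[OF has_derivative_mult[OF
        coordinate_derivatives(1)[OF deriv_A(3)] coordinate_derivatives(4)[OF deriv_h(3)]]]
      simp: algebra_simps)

lemma g_has_derivative:
  assumes "y \<in> U"
  shows "((\<lambda>y. g y v w) has_derivative (\<lambda>u.
      (2 * H1 (fst y) * fst u + 2 * k1 (co1 y) * co1 u) * G1 y * (co1 v * co1 w)
      + (2 * H2 (fst y) * fst u + 2 * k2 (co2 y) * co2 u) * G2 y * (co2 v * co2 w)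
      + (2 * H3 (fst y) * fst u + 2 * k3 (co3 y) * co3 u) * G3 y * (co3 v * co3 w))) (at y)"
proof (rule has_derivative_transform_within_open[OF _ open_U assms g_eq[symmetric]])
  show "((\<lambda>y. - (fst v * fst w) + G1 y * (co1 v * co1 w) + G2 y * (co2 v * co2 w)
    + G3 y * (co3 v * co3 w)) has_derivative (\<lambda>u.
      (2 * H1 (fst y) * fst u + 2 * k1 (co1 y) * co1 u) * G1 y * (co1 v * co1 w)
      + (2 * H2 (fst y) * fst u + 2 * k2 (co2 y) * co2 u) * G2 y * (co2 v * co2 w)
      + (2 * H3 (fst y) * fst u + 2 * k3 (co3 y) * co3 u) * G3 y * (co3 v * co3 w))) (at y)"
    by (auto intro!: derivative_eq_intros G_has_derivative[OF assms])
qed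

lemma \<Gamma>_has_derivative:
  assumes "y \<in> U"
  shows "((\<lambda>y. \<Gamma> a b y u v) has_derivative (\<lambda>h. \<Gamma>' b y h u v)) (at y)"
  unfolding \<Gamma>_def[abs_def] \<Gamma>'_def
  by (intro has_derivative_Pair; rule has_derivative_eq_rhs,
      (rule derivative_intros G_has_derivative[OF assms] H_has_derivative[OF assms]
        k_has_derivative[OF assms])+, auto simp: algebra_simps)

text \<open>\<open>christoffel\<close> is a definite description, so the candidate must satisfy the
  Koszul equation and be its only solution. The metric is diagonal with nonzero entries, so testing
  against the four coordinate vectors isolates the components of a solution.\<close>

lemma christoffel_eq:
  assumes "y \<in> U"
  shows "christoffel g y u v = \<Gamma> 0 0 y u v"
  unfolding christoffel_def frechet_derivative_at[OF g_has_derivative[OF assms], symmetric]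
proof (rule the_equality, intro allI)
  fix w
  show "g y (\<Gamma> 0 0 y u v) w =
    ((2 * H1 (fst y) * fst u + 2 * k1 (co1 y) * co1 u) * G1 y * (co1 v * co1 w)
      + (2 * H2 (fst y) * fst u + 2 * k2 (co2 y) * co2 u) * G2 y * (co2 v * co2 w)
      + (2 * H3 (fst y) * fst u + 2 * k3 (co3 y) * co3 u) * G3 y * (co3 v * co3 w)
      + ((2 * H1 (fst y) * fst v + 2 * k1 (co1 y) * co1 v) * G1 y * (co1 u * co1 w)
      + (2 * H2 (fst y) * fst v + 2 * k2 (co2 y) * co2 v) * G2 y * (co2 u * co2 w)
      + (2 * H3 (fst y) * fst v + 2 * k3 (co3 y) * co3 v) * G3 y * (co3 u * co3 w))
      - ((2 * H1 (fst y) * fst w + 2 * k1 (co1 y) * co1 w) * G1 y * (co1 u * co1 v)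
      + (2 * H2 (fst y) * fst w + 2 * k2 (co2 y) * co2 w) * G2 y * (co2 u * co2 v)
      + (2 * H3 (fst y) * fst w + 2 * k3 (co3 y) * co3 w) * G3 y * (co3 u * co3 v))) / 2" (is "_ = ?K w")
    by (simp add: g_eq[OF assms] \<Gamma>_def field_simps)
  fix z assume z: "\<forall>w. g y z w = ?K w"
  have K: "?K w = g y (\<Gamma> 0 0 y u v) w" for w
    by (simp add: g_eq[OF assms] \<Gamma>_def field_simps)
  have "g y z (1, 0, 0, 0) = g y (\<Gamma> 0 0 y u v) (1, 0, 0, 0)"
    "g y z (0, 1, 0, 0) = g y (\<Gamma> 0 0 y u v) (0, 1, 0, 0)"
    "g y z (0, 0, 1, 0) = g y (\<Gamma> 0 0 y u v) (0, 0, 1, 0)"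
    "g y z (0, 0, 0, 1) = g y (\<Gamma> 0 0 y u v) (0, 0, 0, 1)"
    using z unfolding K by blast+
  then show "z = \<Gamma> 0 0 y u v"
    using G_pos[OF assms] by (simp add: g_eq[OF assms] prod_eq_iff)
qed

text \<open>This explains the entries of \<open>\<Gamma>\<close>: the 1-form dual to
  \<open>d_dt\<close> is \<open>- fst\<close>, so the first extra term adds
  \<open>- a * fst v\<close> times \<open>u\<close>; the second acts in the direction of
  \<open>d_dt\<close> only and shifts the rates by \<open>- b\<close> there, with \<open>+ b\<close>
  on \<open>fst u * fst v\<close> from the Lorentzian sign.\<close>

lemma quarter_symmetric_eq:
  assumes "y \<in> U"
  shows "quarter_symmetric g d_dt a b X Y y =
    frechet_derivative Y (at y) (X y) + \<Gamma> a b y (X y) (Y y)"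
  unfolding quarter_symmetric_def levi_civita_def christoffel_eq[OF assms] d_dt_def
  by (simp add: g_eq[OF assms] \<Gamma>_def prod_eq_iff zero_prod_def algebra_simps)

lemma bilinear_g: "y \<in> U \<Longrightarrow> bilinear (g y)"
  unfolding bilinear_def by (auto intro!: linearI simp: g_eq algebra_simps)

lemma bilinear_\<Gamma>: "bilinear (\<Gamma> a b y)"
  unfolding bilinear_def by (auto intro!: linearI simp: \<Gamma>_def algebra_simps)

lemma bilinear_\<Gamma>': "bilinear (\<Gamma>' b y h)"
  unfolding bilinear_def by (auto intro!: linearI simp: \<Gamma>'_def algebra_simps)

lemma linear_\<Gamma>': "linear (\<lambda>h. \<Gamma>' b y h u v)"
  by (auto intro!: linearI simp: \<Gamma>'_def algebra_simps)

section \<open>The curvature tensor and its double contraction\<close>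

definition riem where
  "riem a b y u v w = \<Gamma>' b y u v w - \<Gamma>' b y v u w + \<Gamma> a b y u (\<Gamma> a b y v w) - \<Gamma> a b y v (\<Gamma> a b y u w)"

lemma linear_riem:
  "linear (\<lambda>u. riem a b y u v w)" "linear (\<lambda>v. riem a b y u v w)" "linear (\<lambda>w. riem a b y u v w)"
  unfolding riem_def
  by - ((rule linearI; simp add: linear_add[OF linear_\<Gamma>'] linear_scale[OF linear_\<Gamma>']
      bilinear_ladd[OF bilinear_\<Gamma>'] bilinear_radd[OF bilinear_\<Gamma>']
      bilinear_lmul[OF bilinear_\<Gamma>'] bilinear_rmul[OF bilinear_\<Gamma>']
      bilinear_ladd[OF bilinear_\<Gamma>] bilinear_radd[OF bilinear_\<Gamma>]
      bilinear_lmul[OF bilinear_\<Gamma>] bilinear_rmul[OF bilinear_\<Gamma>] algebra_simps)+)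

text \<open>Passes from fields to vectors. The neighbourhood \<open>W\<close> is free because the
  fields of a local frame are controlled only on the frame's own domain.\<close>

lemma curvature_eq:
  assumes "open W" "x \<in> W" "W \<subseteq> U" "X differentiable at x" "Y differentiable at x" "C_k_on 2 W Z"
  shows "curvature (quarter_symmetric g d_dt a b) X Y Z x = riem a b x (X x) (Y x) (Z x)"
  unfolding riem_def
  using assms
  by (intro curvature_in_coordinates[where W = W] quarter_symmetric_eq bilinear_\<Gamma>
      \<Gamma>_has_derivative) auto

lemma sum_Basis_4:
  fixes f :: "real \<times> real \<times> real \<times> real \<Rightarrow> real"
  shows "sum f Basis = f (1, 0, 0, 0) + f (0, 1, 0, 0) + f (0, 0, 1, 0) + f (0, 0, 0, 1)"
proof -
  have "(Basis :: (real \<times> real \<times> real \<times> real) set) =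
      {(1, 0, 0, 0), (0, 1, 0, 0), (0, 0, 1, 0), (0, 0, 0, 1)}"
    by (auto simp: Basis_prod_def zero_prod_def)
  then show ?thesis unfolding \<open>Basis = _\<close> by simp
qed

text \<open>For rates proportional to one function \<open>f\<close>, with factors \<open>p1\<close>,
  \<open>p2\<close>, \<open>p3\<close>, the sum of the rates is \<zeta> times \<open>f\<close> and
  the sum of their squares \<eta> times the square of \<open>f\<close>.\<close>

definition scal where
  "scal a b t = - 2 * (H1' t + H2' t + H3' t) - ((H1 t)\<^sup>2 + (H2 t)\<^sup>2 + (H3 t)\<^sup>2) - (H1 t + H2 t + H3 t)\<^sup>2
    + 3 * (a + b) * (H1 t + H2 t + H3 t) + 3 * (a\<^sup>2 + b\<^sup>2 - 4 * a * b)"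

text \<open>The fibre symbols \<open>k1\<close>, \<open>k2\<close>, \<open>k3\<close> cancel in the
  antisymmetrisation over the first two slots, and the factors \<open>G1\<close>, \<open>G2\<close>,
  \<open>G3\<close> cancel against the diagonal of the metric. What remains depends on
  \<open>fst x\<close> alone.\<close>

lemma riem_trace:
  assumes "x \<in> U"
  shows "(\<Sum>e\<in>Basis. (\<Sum>d\<in>Basis. g x (riem a b x e d e) d / g x d d) / g x e e) =
    scal a b (fst x)"
proof -
  let ?e0 = "(1, 0, 0, 0) :: real \<times> real \<times> real \<times> real"
  let ?e1 = "(0, 1, 0, 0) :: real \<times> real \<times> real \<times> real"
  let ?e2 = "(0, 0, 1, 0) :: real \<times> real \<times> real \<times> real"
  let ?e3 = "(0, 0, 0, 1) :: real \<times> real \<times> real \<times> real"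
  let ?r = "\<lambda>e d. g x (riem a b x e d e) d / g x d d"
  note defs = g_eq[OF assms] riem_def \<Gamma>_def \<Gamma>'_def
  note nz = G_pos[OF assms, THEN less_imp_neq, THEN not_sym]
  have r00: "?r ?e0 ?e0 = 0"
    using nz by (simp add: defs field_simps)
  \<comment> \<open>The components with indices 0, 1 and with indices 1, 0 are evaluated separately:
    the connection preserves the metric only for \<open>a = b\<close>, and in general their terms of
    order zero in the rates and linear in them differ.\<close>
  have r01: "?r ?e0 ?e1 = H1' (fst x) + (H1 (fst x) - a) * (H1 (fst x) - b + a)"
    using nz by (simp add: defs field_simps)
  have r02: "?r ?e0 ?e2 = H2' (fst x) + (H2 (fst x) - a) * (H2 (fst x) - b + a)"
    using nz by (simp add: defs field_simps)
  have r03: "?r ?e0 ?e3 = H3' (fst x) + (H3 (fst x) - a) * (H3 (fst x) - b + a)"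
    using nz by (simp add: defs field_simps)
  have r10: "?r ?e1 ?e0 = G1 x * (- H1' (fst x) - (H1 (fst x) - b) * (H1 (fst x) + b - a))"
    using nz by (simp add: defs field_simps)
  have r11: "?r ?e1 ?e1 = 0"
    using nz by (simp add: defs field_simps)
  have r12: "?r ?e1 ?e2 = G1 x * (- ((H1 (fst x) - b) * (H2 (fst x) - a)))"
    using nz by (simp add: defs field_simps)
  have r13: "?r ?e1 ?e3 = G1 x * (- ((H1 (fst x) - b) * (H3 (fst x) - a)))"
    using nz by (simp add: defs field_simps)
  have r20: "?r ?e2 ?e0 = G2 x * (- H2' (fst x) - (H2 (fst x) - b) * (H2 (fst x) + b - a))"
    using nz by (simp add: defs field_simps)
  have r21: "?r ?e2 ?e1 = G2 x * (- ((H2 (fst x) - b) * (H1 (fst x) - a)))"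
    using nz by (simp add: defs field_simps)
  have r22: "?r ?e2 ?e2 = 0"
    using nz by (simp add: defs field_simps)
  have r23: "?r ?e2 ?e3 = G2 x * (- ((H2 (fst x) - b) * (H3 (fst x) - a)))"
    using nz by (simp add: defs field_simps)
  have r30: "?r ?e3 ?e0 = G3 x * (- H3' (fst x) - (H3 (fst x) - b) * (H3 (fst x) + b - a))"
    using nz by (simp add: defs field_simps)
  have r31: "?r ?e3 ?e1 = G3 x * (- ((H3 (fst x) - b) * (H1 (fst x) - a)))"
    using nz by (simp add: defs field_simps)
  have r32: "?r ?e3 ?e2 = G3 x * (- ((H3 (fst x) - b) * (H2 (fst x) - a)))"
    using nz by (simp add: defs field_simps)
  have r33: "?r ?e3 ?e3 = 0"
    using nz by (simp add: defs field_simps)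
  show ?thesis
    unfolding scal_def sum_Basis_4 r00 r01 r02 r03 r10 r11 r12 r13 r20 r21 r22 r23 r30 r31 r32 r33
    using nz by (simp add: g_eq[OF assms] add_divide_distrib diff_divide_distrib)
      (simp add: algebra_simps power2_eq_square)
qed

section \<open>Frames and the scalar curvature\<close>

lemma sum_orthonormal_frame:
  assumes "open W" "x \<in> W" "W \<subseteq> U" and E: "orthonormal_frame g W E"
  shows "(\<Sum>k<DIM(real \<times> real \<times> real \<times> real). g x (E k x) (E k x)
      * ricci g (quarter_symmetric g d_dt a b) E (E k) (E k) x) =
    scal a b (fst x)"
proof -
  have x: "x \<in> U" using assms by blast
  let ?n = "DIM(real \<times> real \<times> real \<times> real)"
  have E_smooth: "C_k_on 2 W (E k)" "E k differentiable at x" if "k < ?n" for k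
    using E that smooth_on_differentiable[of W "E k" x] \<open>x \<in> W\<close>
    by (simp_all add: orthonormal_frame_def smooth_on_def)
  have orth: "g x (E j x) (E k x) = 0" if "j < ?n" "k < ?n" "j \<noteq> k" for j k
    using E that \<open>x \<in> W\<close> unfolding orthonormal_frame_def by blast
  have unit: "g x (E k x) (E k x) \<in> {1, -1}" if "k < ?n" for k
    using E that \<open>x \<in> W\<close> unfolding orthonormal_frame_def by blast
  have sym: "g x v w = g x w v" for v w by (simp add: g_eq[OF x])
  have diag: "g x d e = 0" if "d \<in> Basis" "e \<in> Basis" "d \<noteq> e" for d e
    using that by (auto simp: g_eq[OF x] Basis_prod_def)
  have nz: "g x e e \<noteq> 0" if "e \<in> Basis" for e
    using that G_pos[OF x] by (auto simp: g_eq[OF x] Basis_prod_def)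
  have lin_g: "linear (g x u)" "linear (\<lambda>v. g x v u)" for u
    using bilinear_g[OF x] unfolding bilinear_def by blast+
  note trace = orthonormal_trace[where b = "g x" and E = "\<lambda>k. E k x",
    OF bilinear_g[OF x] sym _ orth unit diag nz]
  have ricci: "ricci g (quarter_symmetric g d_dt a b) E (E j) (E j) x
      = (\<Sum>d\<in>Basis. g x (riem a b x (E j x) d (E j x)) d / g x d d)" if "j < ?n" for j
  proof -
    \<comment> \<open>The inner contraction is taken with \<open>E j\<close> frozen in the first and
      third slot.\<close>
    have "bilinear (\<lambda>u v. g x (riem a b x (E j x) u (E j x)) v)"
      using linear_compose[OF linear_riem(2) lin_g(2)] lin_g(1)
      unfolding bilinear_def o_def by blast
    from trace[OF this] show ?thesis
      using that by (simp add: ricci_def curvature_eq[OF assms(1-3) E_smooth(2,2,1)])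
  qed
  \<comment> \<open>After the inner contraction the Ricci form no longer mentions the frame, so the
    frame can be removed a second time, from the outer sum.\<close>
  have "bilinear (\<lambda>u v. \<Sum>d\<in>Basis. g x (riem a b x u d v) d / g x d d)"
    unfolding bilinear_def divide_inverse
    using linear_compose[OF linear_riem(1) lin_g(2)] linear_compose[OF linear_riem(3) lin_g(2)]
    by (intro conjI allI linear_compose_sum ballI
        linear_compose[OF _ bounded_linear.linear[OF bounded_linear_mult_left], unfolded o_def])
      (simp_all only: o_def)
  from trace[OF this] show ?thesis
    unfolding riem_trace[OF x] by (simp add: ricci)
qed

lemma orthonormal_frame_exists: "\<exists>E. orthonormal_frame g U E"
proof -
  \<comment> \<open>The coordinate fields, normalised by inverse square roots of the metric
    coefficients. The last branch also serves the indices above 3, on which the frame condition is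
    silent.\<close>
  define E :: "nat \<Rightarrow> (real \<times> real \<times> real \<times> real) local_field" where
    "E k y = (if k = 0 then (1, 0, 0, 0) else if k = 1 then (G1 y powr (-1/2)) *\<^sub>R (0, 1, 0, 0)
      else if k = 2 then (G2 y powr (-1/2)) *\<^sub>R (0, 0, 1, 0)
      else (G3 y powr (-1/2)) *\<^sub>R (0, 0, 0, 1))" for k y
  have lin: "bounded_linear (\<lambda>y :: real \<times> real \<times> real \<times> real. fst y)"
    "bounded_linear (\<lambda>y :: real \<times> real \<times> real \<times> real. co1 y)"
    "bounded_linear (\<lambda>y :: real \<times> real \<times> real \<times> real. co2 y)"
    "bounded_linear (\<lambda>y :: real \<times> real \<times> real \<times> real. co3 y)"
    by (auto intro!: bounded_linear_intros)
  have "C_k_on k U (\<lambda>y. G1 y powr r)" "C_k_on k U (\<lambda>y. G2 y powr r)"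
    "C_k_on k U (\<lambda>y. G3 y powr r)" for k r
    using G_pos in_U smooth_base smooth_fibre unfolding smooth_on_def
    by (auto intro!: C_k_on_powr[OF open_U] C_k_on_mult[OF open_U]
        C_k_on_compose_linear[OF open_U lin(1), of I] C_k_on_compose_linear[OF open_U lin(2), of U1]
        C_k_on_compose_linear[OF open_U lin(3), of U2] C_k_on_compose_linear[OF open_U lin(4), of U3]
        simp: G1_def[abs_def] G2_def[abs_def] G3_def[abs_def] pos_base pos_fibre)
  then have "C_k_on j U (\<lambda>y. G1 y powr r *\<^sub>R v)" "C_k_on j U (\<lambda>y. G2 y powr r *\<^sub>R v)"
    "C_k_on j U (\<lambda>y. G3 y powr r *\<^sub>R v)" for j r and v :: "real \<times> real \<times> real \<times> real"
    by (auto intro: C_k_on_linear_compose[OF open_U bounded_linear_scaleR_left])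
  then have smooth: "smooth_on U (E k)" for k
    unfolding smooth_on_def E_def[abs_def]
    by (cases "k = 0"; cases "k = 1"; cases "k = 2")
       (simp_all only: if_True if_False simp_thms C_k_on_const[OF open_U])
  have "r * (r powr - (1/2) * r powr - (1/2)) = 1" if "r > 0" for r :: real
  proof -
    have "r powr - (1/2) * r powr - (1/2) = inverse r"
      using that by (subst powr_add[symmetric]) (simp add: powr_minus)
    then show ?thesis using that by simp
  qed
  then have unit: "G1 y * (G1 y powr - (1/2) * G1 y powr - (1/2)) = 1"
    "G2 y * (G2 y powr - (1/2) * G2 y powr - (1/2)) = 1"
    "G3 y * (G3 y powr - (1/2) * G3 y powr - (1/2)) = 1" if "y \<in> U" for y
    using G_pos[OF that] by blast+
  show ?thesis
    unfolding orthonormal_frame_def using smooth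
    by (intro exI[of _ E]) (auto simp: E_def g_eq unit)
qed

text \<open>The normalised coordinate frame shows that the description is satisfied; the value
  common to all frames shows that it is satisfied only once.\<close>

lemma scalar_curvature_eq:
  assumes "x \<in> U"
  shows "scalar_curvature U g (quarter_symmetric g d_dt a b) x =
    scal a b (fst x)"
  unfolding scalar_curvature_def
proof (rule the_equality)
  obtain E where E: "orthonormal_frame g U E" using orthonormal_frame_exists ..
  show "\<exists>W E. open W \<and> x \<in> W \<and> W \<subseteq> U \<and> orthonormal_frame g W E \<and>
      scal a b (fst x) = (\<Sum>k<DIM(real \<times> real \<times> real \<times> real). g x (E k x) (E k x)
          * ricci g (quarter_symmetric g d_dt a b) E (E k) (E k) x)"
    by (intro exI[of _ U] exI[of _ E] conjI open_U assms order_refl E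
        sum_orthonormal_frame[OF open_U assms order_refl E, symmetric])
qed (use sum_orthonormal_frame in blast)

end

section \<open>Linear differential equations with constant coefficients\<close>

lemma constant_on_interval:
  fixes f :: "real \<Rightarrow> real"
  assumes "is_interval I" "\<And>t. t \<in> I \<Longrightarrow> (f has_real_derivative 0) (at t)"
  obtains c where "\<And>t. t \<in> I \<Longrightarrow> f t = c"
  using has_field_derivative_zero_constant[of I f] assms
  by (metis has_field_derivative_at_within is_interval_convex)

lemma has_real_derivative_unique_on:
  fixes u :: "real \<Rightarrow> real"
  assumes "open I" "t \<in> I" "\<And>t. t \<in> I \<Longrightarrow> u t = F t"
    and "(u has_real_derivative v) (at t)" "(F has_real_derivative F') (at t)"
  shows "v = F'"
  using DERIV_unique[OF has_field_derivative_transform_within_open[OF assms(4,1,2,3)] assms(5)] .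

lemma eq_mult_exp:
  fixes x y t c :: real
  assumes "x * exp (- y * t) = c"
  shows "x = c * exp (y * t)"
  using assms by (auto simp: exp_minus)

context
  fixes I :: "real set" and u v w :: "real \<Rightarrow> real"
  assumes I: "open I" "is_interval I"
    and u: "\<And>t. t \<in> I \<Longrightarrow> (u has_real_derivative v t) (at t)"
    and v: "\<And>t. t \<in> I \<Longrightarrow> (v has_real_derivative w t) (at t)"
begin

text \<open>Agreement with an explicit function on the open set \<open>I\<close> fixes both
  derivatives there, so verifying a proposed solution becomes a computation with closed
  forms.\<close>

lemma second_order_solution:
  assumes eq: "\<And>t. t \<in> I \<Longrightarrow> u t = F t"
    and F: "\<And>t. (F has_real_derivative F' t) (at t)" "\<And>t. (F' has_real_derivative F'' t) (at t)"
  shows "t \<in> I \<Longrightarrow> v t = F' t" "t \<in> I \<Longrightarrow> w t = F'' t"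
proof -
  have v_eq: "v t = F' t" if "t \<in> I" for t
    by (rule has_real_derivative_unique_on[OF I(1) that eq u[OF that] F(1)])
  show "t \<in> I \<Longrightarrow> v t = F' t" by (rule v_eq)
  show "w t = F'' t" if "t \<in> I"
    by (rule has_real_derivative_unique_on[OF I(1) that v_eq v[OF that] F(2)])
qed

text \<open>The operator factors: \<open>v - (a - k) u\<close> satisfies a first-order equation with
  rate \<open>a + k\<close>, and the same holds with \<open>k\<close> negated. Subtracting the two
  first integrals leaves \<open>2 * k * u\<close>, and \<open>k \<noteq> 0\<close> allows the
  division.\<close>

lemma linear_ode_real_roots:
  assumes "k \<noteq> 0"
  shows "(\<forall>t\<in>I. w t = 2 * a * v t - (a\<^sup>2 - k\<^sup>2) * u t) \<longleftrightarrow>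
    (\<exists>c1 c2. \<forall>t\<in>I. u t = c1 * exp ((a + k) * t) + c2 * exp ((a - k) * t))"
proof
  assume w: "\<forall>t\<in>I. w t = 2 * a * v t - (a\<^sup>2 - k\<^sup>2) * u t"
  \<comment> \<open>Both integrals come from one computation, with \<open>l\<close> equal to
    \<open>k\<close> and to \<open>- k\<close>.\<close>
  have "((\<lambda>t. (v t - (a - l) * u t) * exp (- (a + l) * t)) has_real_derivative 0) (at t)"
    if "t \<in> I" "l\<^sup>2 = k\<^sup>2" for t l
  proof -
    have "((\<lambda>t. (v t - (a - l) * u t) * exp (- (a + l) * t)) has_real_derivative
      (w t - 2 * a * v t + (a\<^sup>2 - l\<^sup>2) * u t) * exp (- (a + l) * t)) (at t)"
      by (auto intro!: derivative_eq_intros u v that simp: algebra_simps power2_eq_square)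
    then show ?thesis using w that by simp
  qed
  note const = constant_on_interval[OF I(2) this]
  obtain c where c: "(v t - (a - k) * u t) * exp (- (a + k) * t) = c" if "t \<in> I" for t
    using const[of k] by auto
  obtain d where d: "(v t - (a + k) * u t) * exp (- (a - k) * t) = d" if "t \<in> I" for t
    using const[of "- k"] by auto
  have "u t = c / (2 * k) * exp ((a + k) * t) + (- d / (2 * k)) * exp ((a - k) * t)"
    if t: "t \<in> I" for t
  proof -
    have "v t - (a - k) * u t = c * exp ((a + k) * t)"
      "v t - (a + k) * u t = d * exp ((a - k) * t)"
      using eq_mult_exp[OF c[OF t]] eq_mult_exp[OF d[OF t]] by simp_all
    then have "2 * k * u t = c * exp ((a + k) * t) - d * exp ((a - k) * t)"
      by (simp add: algebra_simps)
    then show ?thesis using \<open>k \<noteq> 0\<close> by (simp add: field_simps)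
  qed
  then show "\<exists>c1 c2. \<forall>t\<in>I. u t = c1 * exp ((a + k) * t) + c2 * exp ((a - k) * t)" by blast
next
  assume "\<exists>c1 c2. \<forall>t\<in>I. u t = c1 * exp ((a + k) * t) + c2 * exp ((a - k) * t)"
  then obtain c1 c2 where eq: "\<And>t. t \<in> I \<Longrightarrow> u t = c1 * exp ((a + k) * t) + c2 * exp ((a - k) * t)"
    by blast
  note vw = second_order_solution[OF eq,
      where F' = "\<lambda>t. c1 * (a + k) * exp ((a + k) * t) + c2 * (a - k) * exp ((a - k) * t)"
        and F'' = "\<lambda>t. c1 * (a + k)\<^sup>2 * exp ((a + k) * t) + c2 * (a - k)\<^sup>2 * exp ((a - k) * t)"]
  show "\<forall>t\<in>I. w t = 2 * a * v t - (a\<^sup>2 - k\<^sup>2) * u t"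
  proof
    fix t assume t: "t \<in> I"
    have "v t = c1 * (a + k) * exp ((a + k) * t) + c2 * (a - k) * exp ((a - k) * t)"
      by (rule vw(1)) (auto intro!: derivative_eq_intros t simp: power2_eq_square)
    moreover have "w t = c1 * (a + k)\<^sup>2 * exp ((a + k) * t) + c2 * (a - k)\<^sup>2 * exp ((a - k) * t)"
      by (rule vw(2)) (auto intro!: derivative_eq_intros t simp: power2_eq_square)
    ultimately show "w t = 2 * a * v t - (a\<^sup>2 - k\<^sup>2) * u t"
      by (simp only: eq[OF t]) (simp add: algebra_simps power2_eq_square)
  qed
qed

text \<open>The two linear factors coincide, so they are integrated one after the other: the first
  integral \<open>d\<close> becomes the constant derivative of \<open>u t * exp (- a * t)\<close>,
  which produces the term linear in \<open>t\<close>.\<close>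

lemma linear_ode_double_root:
  "(\<forall>t\<in>I. w t = 2 * a * v t - a\<^sup>2 * u t) \<longleftrightarrow>
    (\<exists>c1 c2. \<forall>t\<in>I. u t = c1 * exp (a * t) + c2 * t * exp (a * t))"
proof
  assume w: "\<forall>t\<in>I. w t = 2 * a * v t - a\<^sup>2 * u t"
  have "((\<lambda>t. (v t - a * u t) * exp (- a * t)) has_real_derivative 0) (at t)" if "t \<in> I" for t
  proof -
    have "((\<lambda>t. (v t - a * u t) * exp (- a * t)) has_real_derivative
      (w t - 2 * a * v t + a\<^sup>2 * u t) * exp (- a * t)) (at t)"
      by (auto intro!: derivative_eq_intros u v that simp: algebra_simps power2_eq_square)
    then show ?thesis using w that by simp
  qed
  then obtain d where d: "\<And>t. t \<in> I \<Longrightarrow> (v t - a * u t) * exp (- a * t) = d"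
    using constant_on_interval[OF I(2)] by blast
  have "((\<lambda>t. u t * exp (- a * t) - d * t) has_real_derivative 0) (at t)" if "t \<in> I" for t
  proof -
    have "((\<lambda>t. u t * exp (- a * t) - d * t) has_real_derivative
      (v t - a * u t) * exp (- a * t) - d) (at t)"
      by (auto intro!: derivative_eq_intros u that simp: algebra_simps)
    then show ?thesis using d that by simp
  qed
  then obtain c where c: "\<And>t. t \<in> I \<Longrightarrow> u t * exp (- a * t) - d * t = c"
    using constant_on_interval[OF I(2)] by blast
  have "u t = c * exp (a * t) + d * t * exp (a * t)" if "t \<in> I" for t
    using c[OF that] by (simp add: exp_minus field_simps)
  then show "\<exists>c1 c2. \<forall>t\<in>I. u t = c1 * exp (a * t) + c2 * t * exp (a * t)" by blast
next
  assume "\<exists>c1 c2. \<forall>t\<in>I. u t = c1 * exp (a * t) + c2 * t * exp (a * t)"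
  then obtain c1 c2 where eq: "\<And>t. t \<in> I \<Longrightarrow> u t = c1 * exp (a * t) + c2 * t * exp (a * t)"
    by blast
  note vw = second_order_solution[OF eq,
      where F' = "\<lambda>t. (a * c1 + c2 + a * c2 * t) * exp (a * t)"
        and F'' = "\<lambda>t. (a\<^sup>2 * c1 + 2 * a * c2 + a\<^sup>2 * c2 * t) * exp (a * t)"]
  show "\<forall>t\<in>I. w t = 2 * a * v t - a\<^sup>2 * u t"
  proof
    fix t assume t: "t \<in> I"
    have "v t = (a * c1 + c2 + a * c2 * t) * exp (a * t)"
      by (rule vw(1)) (auto intro!: derivative_eq_intros t simp: power2_eq_square algebra_simps)
    moreover have "w t = (a\<^sup>2 * c1 + 2 * a * c2 + a\<^sup>2 * c2 * t) * exp (a * t)"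
      by (rule vw(2)) (auto intro!: derivative_eq_intros t simp: power2_eq_square algebra_simps)
    ultimately show "w t = 2 * a * v t - a\<^sup>2 * u t"
      by (simp only: eq[OF t]) (simp add: algebra_simps power2_eq_square)
  qed
qed

text \<open>After removal of the factor \<open>exp (a * t)\<close> the equation is a harmonic
  oscillator. The pair formed by \<open>k\<close> times its solution and the derivative of the
  solution rotates with speed \<open>k\<close>; undoing the rotation gives the two first integrals
  \<open>c\<close> and \<open>d\<close>.\<close>

lemma linear_ode_complex_roots:
  assumes "k \<noteq> 0"
  shows "(\<forall>t\<in>I. w t = 2 * a * v t - (a\<^sup>2 + k\<^sup>2) * u t) \<longleftrightarrow>
    (\<exists>c1 c2. \<forall>t\<in>I. u t = c1 * exp (a * t) * cos (k * t) + c2 * exp (a * t) * sin (k * t))"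
proof
  assume w: "\<forall>t\<in>I. w t = 2 * a * v t - (a\<^sup>2 + k\<^sup>2) * u t"
  have "((\<lambda>t. exp (- a * t) * (k * u t * cos (k * t) - (v t - a * u t) * sin (k * t)))
      has_real_derivative 0) (at t)" if "t \<in> I" for t
  proof -
    have "((\<lambda>t. exp (- a * t) * (k * u t * cos (k * t) - (v t - a * u t) * sin (k * t)))
      has_real_derivative
      exp (- a * t) * (- sin (k * t) * (w t - 2 * a * v t + (a\<^sup>2 + k\<^sup>2) * u t))) (at t)"
      by (auto intro!: derivative_eq_intros u v that simp: algebra_simps power2_eq_square)
    then show ?thesis using w that by simp
  qed
  then obtain c where c: "\<And>t. t \<in> I \<Longrightarrow>
      exp (- a * t) * (k * u t * cos (k * t) - (v t - a * u t) * sin (k * t)) = c"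
    using constant_on_interval[OF I(2)] by blast
  have "((\<lambda>t. exp (- a * t) * (k * u t * sin (k * t) + (v t - a * u t) * cos (k * t)))
      has_real_derivative 0) (at t)" if "t \<in> I" for t
  proof -
    have "((\<lambda>t. exp (- a * t) * (k * u t * sin (k * t) + (v t - a * u t) * cos (k * t)))
      has_real_derivative
      exp (- a * t) * (cos (k * t) * (w t - 2 * a * v t + (a\<^sup>2 + k\<^sup>2) * u t))) (at t)"
      by (auto intro!: derivative_eq_intros u v that simp: algebra_simps power2_eq_square)
    then show ?thesis using w that by simp
  qed
  then obtain d where d: "\<And>t. t \<in> I \<Longrightarrow>
      exp (- a * t) * (k * u t * sin (k * t) + (v t - a * u t) * cos (k * t)) = d"
    using constant_on_interval[OF I(2)] by blast
  have "u t = c / k * exp (a * t) * cos (k * t) + d / k * exp (a * t) * sin (k * t)"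
    if t: "t \<in> I" for t
  proof -
    have "c * cos (k * t) + d * sin (k * t)
        = exp (- a * t) * (k * u t * ((cos (k * t))\<^sup>2 + (sin (k * t))\<^sup>2))"
      unfolding c[OF t, symmetric] d[OF t, symmetric] by algebra
    then have "k * u t = (c * cos (k * t) + d * sin (k * t)) * exp (a * t)"
      by (simp add: exp_minus field_simps)
    then show ?thesis using \<open>k \<noteq> 0\<close> by (simp add: field_simps)
  qed
  then show "\<exists>c1 c2. \<forall>t\<in>I. u t = c1 * exp (a * t) * cos (k * t) + c2 * exp (a * t) * sin (k * t)"
    by blast
next
  assume "\<exists>c1 c2. \<forall>t\<in>I. u t = c1 * exp (a * t) * cos (k * t) + c2 * exp (a * t) * sin (k * t)"
  then obtain c1 c2 where eq: "\<And>t. t \<in> I \<Longrightarrow>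
      u t = c1 * exp (a * t) * cos (k * t) + c2 * exp (a * t) * sin (k * t)"
    by blast
  \<comment> \<open>Differentiation sends the coefficients \<open>(p, q)\<close> of cosine and sine,
    after the common exponential, to \<open>(a * p + k * q, a * q - k * p)\<close>; this is applied
    twice to \<open>(c1, c2)\<close>.\<close>
  note vw = second_order_solution[OF eq,
      where F' = "\<lambda>t. exp (a * t) * ((a * c1 + k * c2) * cos (k * t) + (a * c2 - k * c1) * sin (k * t))"
        and F'' = "\<lambda>t. exp (a * t) * ((a * (a * c1 + k * c2) + k * (a * c2 - k * c1)) * cos (k * t)
          + (a * (a * c2 - k * c1) - k * (a * c1 + k * c2)) * sin (k * t))"]
  show "\<forall>t\<in>I. w t = 2 * a * v t - (a\<^sup>2 + k\<^sup>2) * u t"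
  proof
    fix t assume t: "t \<in> I"
    have "v t = exp (a * t) * ((a * c1 + k * c2) * cos (k * t) + (a * c2 - k * c1) * sin (k * t))"
      by (rule vw(1)) (auto intro!: derivative_eq_intros t simp: algebra_simps)
    moreover have "w t = exp (a * t) * ((a * (a * c1 + k * c2) + k * (a * c2 - k * c1)) * cos (k * t)
          + (a * (a * c2 - k * c1) - k * (a * c1 + k * c2)) * sin (k * t))"
      by (rule vw(2)) (auto intro!: derivative_eq_intros t simp: algebra_simps)
    ultimately show "w t = 2 * a * v t - (a\<^sup>2 + k\<^sup>2) * u t"
      by (simp only: eq[OF t]) (simp add: algebra_simps power2_eq_square)
  qed
qed

end

section \<open>Logarithmic derivatives and exponential solutions\<close>

lemma log_derivative:
  fixes h :: "real \<Rightarrow> real"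
  assumes "open S" "smooth_on S h" "\<And>s. s \<in> S \<Longrightarrow> h s > 0"
  obtains k k' where "\<And>s. s \<in> S \<Longrightarrow> (h has_real_derivative k s * h s) (at s)"
    "\<And>s. s \<in> S \<Longrightarrow> (k has_real_derivative k' s) (at s)"
proof -
  obtain h' where h': "smooth_on S h'" "\<And>s. s \<in> S \<Longrightarrow> (h has_real_derivative h' s) (at s)"
    using smooth_on_real_derivative[OF assms(1,2)] by metis
  obtain h'' where h'': "\<And>s. s \<in> S \<Longrightarrow> (h' has_real_derivative h'' s) (at s)"
    using smooth_on_real_derivative[OF assms(1) h'(1)] by metis
  show ?thesis
  proof
    fix s assume s: "s \<in> S"
    show "(h has_real_derivative h' s / h s * h s) (at s)"
      using h'(2)[OF s] assms(3)[OF s] by simp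
    show "((\<lambda>s. h' s / h s) has_real_derivative (h'' s * h s - h' s * h' s) / (h s * h s)) (at s)"
      using DERIV_divide[OF h''[OF s] h'(2)[OF s]] assms(3)[OF s] by simp
  qed
qed

text \<open>The squared equation leaves a sign open at every point. As \<open>f\<close> is
  continuous on an interval, changing the sign would force a zero of \<open>f\<close>, which is
  impossible for \<open>m \<noteq> 0\<close>; so a single \<open>s\<close> works throughout.\<close>

lemma log_derivative_square_constant:
  fixes h :: "real \<Rightarrow> real"
  assumes I: "open I" "is_interval I" "I \<noteq> {}" and "m \<ge> 0"
    and h: "\<And>t. t \<in> I \<Longrightarrow> (h has_real_derivative f t * h t) (at t)"
    and f: "continuous_on I f" and pos: "\<And>t. t \<in> I \<Longrightarrow> h t > 0"
  shows "(\<forall>t\<in>I. (f t)\<^sup>2 = m\<^sup>2) \<longleftrightarrow> (\<exists>c. \<exists>s\<in>{1, -1}. \<forall>t\<in>I. h t = c * exp (s * m * t))"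
proof
  assume sq: "\<forall>t\<in>I. (f t)\<^sup>2 = m\<^sup>2"
  have "(\<forall>t\<in>I. f t = m) \<or> (\<forall>t\<in>I. f t = - m)"
  proof (rule ccontr)
    assume "\<not> ?thesis"
    then obtain t t' where t: "t \<in> I" "f t \<noteq> m" "t' \<in> I" "f t' \<noteq> - m" by blast
    \<comment> \<open>For \<open>m = 0\<close> the two alternatives coincide and cannot both fail,
      hence \<open>m \<noteq> 0\<close>.\<close>
    then have "f t = - m" "f t' = m" "m \<noteq> 0"
      using sq power2_eq_iff by (metis, metis, metis add.inverse_neutral)
    moreover have "is_interval (f ` I)"
      using connected_continuous_image[OF f] I(2) by (simp add: is_interval_connected_1)
    ultimately have "0 \<in> f ` I"
      using t \<open>m \<ge> 0\<close> unfolding is_interval_1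
      by (metis imageI neg_le_0_iff_le)
    then show False using sq \<open>m \<noteq> 0\<close> by force
  qed
  then have "\<exists>s\<in>{1, -1}. \<forall>t\<in>I. f t = s * m" by simp
  then obtain s where s: "s \<in> {1, -1}" "\<And>t. t \<in> I \<Longrightarrow> f t = s * m" by blast
  have "((\<lambda>t. h t * exp (- (s * m) * t)) has_real_derivative 0) (at t)" if "t \<in> I" for t
    using h[OF that] unfolding s(2)[OF that]
    by (auto intro!: derivative_eq_intros)
  then obtain c where "\<And>t. t \<in> I \<Longrightarrow> h t * exp (- (s * m) * t) = c"
    using constant_on_interval[OF I(2)] by blast
  then have "\<forall>t\<in>I. h t = c * exp (s * m * t)" by (auto simp: exp_minus field_simps)
  with s(1) show "\<exists>c. \<exists>s\<in>{1, -1}. \<forall>t\<in>I. h t = c * exp (s * m * t)" by blast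
next
  assume "\<exists>c. \<exists>s\<in>{1, -1}. \<forall>t\<in>I. h t = c * exp (s * m * t)"
  then obtain c s where s: "s \<in> {1, -1}" and eq: "\<And>t. t \<in> I \<Longrightarrow> h t = c * exp (s * m * t)" by blast
  show "\<forall>t\<in>I. (f t)\<^sup>2 = m\<^sup>2"
  proof
    fix t assume t: "t \<in> I"
    have "f t * h t = c * (exp (s * m * t) * (s * m))"
      by (rule has_real_derivative_unique_on[OF I(1) t eq h[OF t]])
        (auto intro!: derivative_eq_intros)
    then have "f t = s * m"
      using pos[OF t] eq[OF t]
      by (metis less_irrefl mult.assoc mult.commute mult_cancel_right)
    then show "(f t)\<^sup>2 = m\<^sup>2" using s by auto
  qed
qed

section \<open>Kasner space-times\<close>

lemma powr_log_derivative:
  fixes h :: "real \<Rightarrow> real"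
  assumes "(h has_real_derivative f * h t) (at t)" "h t > 0"
  shows "((\<lambda>t. h t powr r) has_real_derivative r * f * h t powr r) (at t)"
proof -
  have "h t powr (r - 1) * h t = h t powr r" using assms(2) by (simp add: powr_diff)
  from arg_cong[OF this, of "\<lambda>x. r * f * x"]
  have "r * h t powr (r - 1) * (f * h t) = r * f * h t powr r"
    by (simp only: mult_ac)
  with DERIV_chain2[OF has_real_derivative_powr[OF assms(2)] assms(1), of r]
  show ?thesis by (simp only:)
qed

lemma smooth_on_powr:
  fixes f :: "'a::euclidean_space \<Rightarrow> real"
  assumes "open S" "smooth_on S f" "\<And>x. x \<in> S \<Longrightarrow> f x > 0"
  shows "smooth_on S (\<lambda>x. f x powr r)"
  using C_k_on_powr[OF assms(1,3)] assms(2) by (simp add: smooth_on_def)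

text \<open>A bilinear form on a line is determined by its value at the pair of unit vectors, so in
  a chart the metric of a fibre is a single positive smooth coefficient.\<close>

lemma line_metric:
  fixes g :: "'i \<Rightarrow> real local_metric"
  assumes "smooth_manifold F" "riemannian_metric F g" "i \<in> charts F"
  shows "open (cimage F i)"
    and "smooth_on (cimage F i) (\<lambda>x. g i x 1 1)"
    and "x \<in> cimage F i \<Longrightarrow> g i x 1 1 > 0"
    and "x \<in> cimage F i \<Longrightarrow> g i x v w = g i x 1 1 * (v * w)"
proof -
  show "open (cimage F i)" using assms by (simp add: smooth_manifold_def)
  show "smooth_on (cimage F i) (\<lambda>x. g i x 1 1)"
    using assms by (simp add: riemannian_metric_def pseudo_riemannian_metric_def)
  show "g i x 1 1 > 0" if "x \<in> cimage F i"
    using assms that by (simp add: riemannian_metric_def)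
  show "g i x v w = g i x 1 1 * (v * w)" if "x \<in> cimage F i"
  proof -
    have "bilinear (g i x)"
      using assms that by (simp add: riemannian_metric_def pseudo_riemannian_metric_def)
    from bilinear_lmul[OF this, of v 1 w] bilinear_rmul[OF this, of 1 w 1] show ?thesis by simp
  qed
qed

lemma smooth_manifold_chart:
  assumes "smooth_manifold F"
  obtains i q where "i \<in> charts F" "q \<in> cdom F i"
  using assms unfolding smooth_manifold_def by blast

lemma kasner_scalar_curvature:
  fixes p1 p2 p3 a b :: real and F1 :: "('p1, real, 'i1) atlas" and F2 :: "('p2, real, 'i2) atlas"
    and F3 :: "('p3, real, 'i3) atlas"
  assumes I: "open I" and \<phi>: "smooth_on I \<phi>" "\<And>t. t \<in> I \<Longrightarrow> \<phi> t > 0"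
    and F1: "smooth_manifold F1" "riemannian_metric F1 g1" "i1 \<in> charts F1"
    and F2: "smooth_manifold F2" "riemannian_metric F2 g2" "i2 \<in> charts F2"
    and F3: "smooth_manifold F3" "riemannian_metric F3 g3" "i3 \<in> charts F3"
    and f: "\<And>t. t \<in> I \<Longrightarrow> (\<phi> has_real_derivative f t * \<phi> t) (at t)"
    and f': "\<And>t. t \<in> I \<Longrightarrow> (f has_real_derivative f' t) (at t)"
    and x: "(t, s) \<in> I \<times> cimage F1 i1 \<times> cimage F2 i2 \<times> cimage F3 i3"
  defines "g \<equiv> kasner_metric \<phi> p1 p2 p3 g1 g2 g3 ((), i1, i2, i3)"
  shows "scalar_curvature (I \<times> cimage F1 i1 \<times> cimage F2 i2 \<times> cimage F3 i3) g
      (quarter_symmetric g d_dt a b) (t, s) =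
    - 2 * (p1 + p2 + p3) * f' t - (p1\<^sup>2 + p2\<^sup>2 + p3\<^sup>2 + (p1 + p2 + p3)\<^sup>2) * (f t)\<^sup>2
    + 3 * (a + b) * (p1 + p2 + p3) * f t + 3 * (a\<^sup>2 + b\<^sup>2 - 4 * a * b)"
proof -
  note h1 = line_metric[OF F1] and h2 = line_metric[OF F2] and h3 = line_metric[OF F3]
  \<comment> \<open>Halves the logarithmic derivative to match the factor 2 in
    \<open>warped_lines\<close>.\<close>
  have fibre: "\<exists>k k'. (\<forall>s\<in>S. (h has_real_derivative 2 * k s * h s) (at s)) \<and>
      (\<forall>s\<in>S. (k has_real_derivative k' s) (at s))"
    if S: "open S" "smooth_on S h" "\<And>s. s \<in> S \<Longrightarrow> h s > 0" for S and h :: "real \<Rightarrow> real"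
  proof -
    obtain k k' where k: "\<And>s. s \<in> S \<Longrightarrow> (h has_real_derivative k s * h s) (at s)"
      "\<And>s. s \<in> S \<Longrightarrow> (k has_real_derivative k' s) (at s)"
      using log_derivative[OF S] by metis
    show ?thesis
      by (rule exI[of _ "\<lambda>s. k s / 2"], rule exI[of _ "\<lambda>s. k' s / 2"])
        (auto intro!: k DERIV_cdivide)
  qed
  obtain k1 k1' where k1: "\<And>s. s \<in> cimage F1 i1 \<Longrightarrow>
        ((\<lambda>x. g1 i1 x 1 1) has_real_derivative 2 * k1 s * g1 i1 s 1 1) (at s)"
      "\<And>s. s \<in> cimage F1 i1 \<Longrightarrow> (k1 has_real_derivative k1' s) (at s)"
    using fibre[OF h1(1-3)] by auto
  obtain k2 k2' where k2: "\<And>s. s \<in> cimage F2 i2 \<Longrightarrow>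
        ((\<lambda>x. g2 i2 x 1 1) has_real_derivative 2 * k2 s * g2 i2 s 1 1) (at s)"
      "\<And>s. s \<in> cimage F2 i2 \<Longrightarrow> (k2 has_real_derivative k2' s) (at s)"
    using fibre[OF h2(1-3)] by auto
  obtain k3 k3' where k3: "\<And>s. s \<in> cimage F3 i3 \<Longrightarrow>
        ((\<lambda>x. g3 i3 x 1 1) has_real_derivative 2 * k3 s * g3 i3 s 1 1) (at s)"
      "\<And>s. s \<in> cimage F3 i3 \<Longrightarrow> (k3 has_real_derivative k3' s) (at s)"
    using fibre[OF h3(1-3)] by auto
  \<comment> \<open>The squared warping factor has exponent \<open>2 * p\<close>, so half its
    logarithmic derivative is the rate \<open>p * f t\<close>.\<close>
  have warp: "((\<lambda>t. \<phi> t powr (2 * p)) has_real_derivative 2 * (p * f t) * \<phi> t powr (2 * p)) (at t)"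
    if "t \<in> I" for t p
    using powr_log_derivative[OF f[OF that] \<phi>(2)[OF that], of "2 * p"]
    by (simp only: mult.assoc)
  have warp_pos: "\<phi> t powr p > 0" if "t \<in> I" for t p
    using \<phi>(2)[OF that] by simp
  have warp_log: "((\<lambda>t. p * f t) has_real_derivative p * f' t) (at t)" if "t \<in> I" for t p
    by (rule DERIV_cmult[OF f'[OF that]])
  have warp_smooth: "smooth_on I (\<lambda>t. \<phi> t powr p)" for p
    by (rule smooth_on_powr[OF I \<phi>])
  interpret warped_lines I "cimage F1 i1" "cimage F2 i2" "cimage F3 i3"
    "\<lambda>t. \<phi> t powr (2 * p1)" "\<lambda>t. \<phi> t powr (2 * p2)" "\<lambda>t. \<phi> t powr (2 * p3)"
    "\<lambda>t. p1 * f t" "\<lambda>t. p2 * f t" "\<lambda>t. p3 * f t" "\<lambda>t. p1 * f' t" "\<lambda>t. p2 * f' t" "\<lambda>t. p3 * f' t"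
    "\<lambda>s. g1 i1 s 1 1" "\<lambda>s. g2 i2 s 1 1" "\<lambda>s. g3 i3 s 1 1" k1 k2 k3 k1' k2' k3' g
  proof
    show "g y v w = - (fst v * fst w)
        + \<phi> (fst y) powr (2 * p1) * g1 i1 (co1 y) 1 1 * (co1 v * co1 w)
        + \<phi> (fst y) powr (2 * p2) * g2 i2 (co2 y) 1 1 * (co2 v * co2 w)
        + \<phi> (fst y) powr (2 * p3) * g3 i3 (co3 y) 1 1 * (co3 v * co3 w)"
      if "y \<in> I \<times> cimage F1 i1 \<times> cimage F2 i2 \<times> cimage F3 i3" for y v w
    proof -
      obtain t x1 x2 x3 where y: "y = (t, x1, x2, x3)" by (metis prod.exhaust)
      show ?thesis
        using that h1(4)[of x1 "co1 v" "co1 w"] h2(4)[of x2 "co2 v" "co2 w"] h3(4)[of x3 "co3 v" "co3 w"]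
        by (simp add: y g_def kasner_metric_def split_beta)
    qed
  qed (fact I h1(1-3) h2(1-3) h3(1-3) k1 k2 k3 warp warp_pos warp_log warp_smooth)+
  show ?thesis
    using scalar_curvature_eq[of "(t, s)" a b] x
    by (simp add: U_def scal_def algebra_simps power2_eq_square)
qed

text \<open>The value in a chart depends only on \<open>t\<close>, and the interval has one global
  chart. Fixing one charted point in each fibre, which exists because manifolds are nonempty and
  covered by charts, lets \<open>t\<close> run through all of \<open>I\<close>.\<close>

lemma kasner_constant_scalar_curvature_iff:
  fixes p1 p2 p3 a b :: real and F1 :: "('p1, real, 'i1) atlas" and F2 :: "('p2, real, 'i2) atlas"
    and F3 :: "('p3, real, 'i3) atlas"
  assumes I: "open I" and \<phi>: "smooth_on I \<phi>" "\<And>t. t \<in> I \<Longrightarrow> \<phi> t > 0"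
    and F1: "smooth_manifold F1" "riemannian_metric F1 g1"
    and F2: "smooth_manifold F2" "riemannian_metric F2 g2"
    and F3: "smooth_manifold F3" "riemannian_metric F3 g3"
    and f: "\<And>t. t \<in> I \<Longrightarrow> (\<phi> has_real_derivative f t * \<phi> t) (at t)"
    and f': "\<And>t. t \<in> I \<Longrightarrow> (f has_real_derivative f' t) (at t)"
  defines "g \<equiv> kasner_metric \<phi> p1 p2 p3 g1 g2 g3"
  shows "has_constant_scalar_curvature (kasner_space I F1 F2 F3) g
      (\<lambda>i. quarter_symmetric (g i) d_dt a b) S \<longleftrightarrow>
    (\<forall>t\<in>I. - 2 * (p1 + p2 + p3) * f' t - (p1\<^sup>2 + p2\<^sup>2 + p3\<^sup>2 + (p1 + p2 + p3)\<^sup>2) * (f t)\<^sup>2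
      + 3 * (a + b) * (p1 + p2 + p3) * f t + 3 * (a\<^sup>2 + b\<^sup>2 - 4 * a * b) = S)" (is "_ \<longleftrightarrow> (\<forall>t\<in>I. ?S t = S)")
proof -
  let ?M = "kasner_space I F1 F2 F3"
  note defs = kasner_space_def prod_atlas_def interval_atlas_def
  have charts: "charts ?M = {()} \<times> charts F1 \<times> charts F2 \<times> charts F3"
    by (simp add: defs)
  have cdom: "cdom ?M (u, i1, i2, i3) = I \<times> cdom F1 i1 \<times> cdom F2 i2 \<times> cdom F3 i3" for u i1 i2 i3
    by (simp add: defs)
  have coord: "coord ?M (u, i1, i2, i3) (t, q1, q2, q3) = (t, coord F1 i1 q1, coord F2 i2 q2, coord F3 i3 q3)"
    for u i1 i2 i3 t q1 q2 q3
    by (simp add: defs)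
  have cimage: "cimage ?M (u, i1, i2, i3) = I \<times> cimage F1 i1 \<times> cimage F2 i2 \<times> cimage F3 i3"
    for u i1 i2 i3
    unfolding Defs.cimage_def cdom by (force simp: coord image_iff)
  have S: "scalar_curvature (cimage ?M ((), i1, i2, i3)) (g ((), i1, i2, i3))
      (quarter_symmetric (g ((), i1, i2, i3)) d_dt a b) (coord ?M ((), i1, i2, i3) (t, q1, q2, q3)) = ?S t"
    if "i1 \<in> charts F1" "i2 \<in> charts F2" "i3 \<in> charts F3"
      "t \<in> I" "q1 \<in> cdom F1 i1" "q2 \<in> cdom F2 i2" "q3 \<in> cdom F3 i3" for i1 i2 i3 t q1 q2 q3
    unfolding cimage coord g_def
    by (rule kasner_scalar_curvature[OF I \<phi> F1 that(1) F2 that(2) F3 that(3) f f'])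
      (use that in \<open>auto simp: Defs.cimage_def\<close>)
  show ?thesis
  proof
    assume const: "has_constant_scalar_curvature ?M g (\<lambda>i. quarter_symmetric (g i) d_dt a b) S"
    obtain i1 q1 i2 q2 i3 q3 where
      "i1 \<in> charts F1" "q1 \<in> cdom F1 i1" "i2 \<in> charts F2" "q2 \<in> cdom F2 i2"
      "i3 \<in> charts F3" "q3 \<in> cdom F3 i3"
      using smooth_manifold_chart F1(1) F2(1) F3(1) by metis
    note S' = S[OF this(1,3,5) _ this(2,4,6)] and q = this
    show "\<forall>t\<in>I. ?S t = S"
    proof
      fix t assume t: "t \<in> I"
      have "((), i1, i2, i3) \<in> charts ?M" "(t, q1, q2, q3) \<in> cdom ?M ((), i1, i2, i3)"
        using q t by (auto simp: charts cdom)
      then show "?S t = S"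
        using const S'[OF t] unfolding has_constant_scalar_curvature_def by metis
    qed
  next
    assume "\<forall>t\<in>I. ?S t = S"
    then show "has_constant_scalar_curvature ?M g (\<lambda>i. quarter_symmetric (g i) d_dt a b) S"
      unfolding has_constant_scalar_curvature_def
      by (auto simp: charts cdom S)
  qed
qed

theorem theorem4p21:
  fixes I :: "real set" and \<phi> \<psi> :: "real \<Rightarrow> real"
    and p1 p2 p3 \<zeta> \<eta> lam1 lam2 S D :: real
    and F1 :: "('p1, real, 'i1) atlas" and F2 :: "('p2, real, 'i2) atlas"
    and F3 :: "('p3, real, 'i3) atlas"
    and g1 :: "'i1 \<Rightarrow> real local_metric" and g2 :: "'i2 \<Rightarrow> real local_metric"
    and g3 :: "'i3 \<Rightarrow> real local_metric"
    and M :: "(real \<times> 'p1 \<times> 'p2 \<times> 'p3, real \<times> real \<times> real \<times> real, unit \<times> 'i1 \<times> 'i2 \<times> 'i3) atlas"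
    and g :: "unit \<times> 'i1 \<times> 'i2 \<times> 'i3 \<Rightarrow> (real \<times> real \<times> real \<times> real) local_metric"
  assumes "open I" and "is_interval I" and "I \<noteq> {}"
    and "smooth_on I \<phi>" and "\<forall>t\<in>I. \<phi> t > 0"
    and "smooth_manifold F1" and "riemannian_metric F1 g1"
    and "smooth_manifold F2" and "riemannian_metric F2 g2"
    and "smooth_manifold F3" and "riemannian_metric F3 g3"
    and "M = kasner_space I F1 F2 F3"
    and "g = kasner_metric \<phi> p1 p2 p3 g1 g2 g3"
    and "lam1 \<noteq> 0" and "lam2 \<noteq> 0"
    and "\<zeta> = p1 + p2 + p3" and "\<eta> = p1\<^sup>2 + p2\<^sup>2 + p3\<^sup>2"
    and "\<zeta> \<noteq> 0 \<Longrightarrow> \<forall>t\<in>I. \<psi> t > 0 \<and> \<phi> t = \<psi> t powr (2 * \<zeta> / (\<eta> + \<zeta>\<^sup>2))"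
    and "D = 9 * (lam1 + lam2)\<^sup>2 / 4 - (S - 3 * lam1\<^sup>2 - 3 * lam2\<^sup>2 + 12 * lam1 * lam2) * (\<eta> + \<zeta>\<^sup>2) / \<zeta>\<^sup>2"
  shows "has_constant_scalar_curvature M g (\<lambda>i. quarter_symmetric (g i) d_dt lam1 lam2) S \<longleftrightarrow>
    (\<zeta> = 0 \<and> \<eta> = 0 \<and> S = 3 * (lam1\<^sup>2 + lam2\<^sup>2 - 4 * lam1 * lam2))
    \<or> (\<zeta> = 0 \<and> \<eta> \<noteq> 0 \<and>
        (S > 3 * (lam1\<^sup>2 + lam2\<^sup>2 - 4 * lam1 * lam2) \<longrightarrow> False) \<and>
        (S = 3 * (lam1\<^sup>2 + lam2\<^sup>2 - 4 * lam1 * lam2) \<longrightarrow> (\<exists>c. \<forall>t\<in>I. \<phi> t = c)) \<and>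
        (S < 3 * (lam1\<^sup>2 + lam2\<^sup>2 - 4 * lam1 * lam2) \<longrightarrow>
          (\<exists>c0. \<exists>s\<in>{1, -1}. \<forall>t\<in>I.
             \<phi> t = c0 * exp (s * sqrt ((3 * (lam1\<^sup>2 + lam2\<^sup>2 - 4 * lam1 * lam2) - S) / \<eta>) * t))))
    \<or> (\<zeta> \<noteq> 0 \<and>
        ((S < 9 * \<zeta>\<^sup>2 * (lam1 + lam2)\<^sup>2 / (4 * (\<eta> + \<zeta>\<^sup>2)) + 3 * lam1\<^sup>2 + 3 * lam2\<^sup>2 - 12 * lam1 * lam2 \<and>
           (\<exists>c1 c2. \<forall>t\<in>I. \<psi> t = c1 * exp (1/2 * (3/2 * (lam1 + lam2) + sqrt D) * t)
                                + c2 * exp (1/2 * (3/2 * (lam1 + lam2) - sqrt D) * t)))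
       \<or> (S = 9 * \<zeta>\<^sup>2 * (lam1 + lam2)\<^sup>2 / (4 * (\<eta> + \<zeta>\<^sup>2)) + 3 * lam1\<^sup>2 + 3 * lam2\<^sup>2 - 12 * lam1 * lam2 \<and>
           (\<exists>c1 c2. \<forall>t\<in>I. \<psi> t = c1 * exp (3 * (lam1 + lam2) / 4 * t)
                                + c2 * t * exp (3 * (lam1 + lam2) / 4 * t)))
       \<or> (S > 9 * \<zeta>\<^sup>2 * (lam1 + lam2)\<^sup>2 / (4 * (\<eta> + \<zeta>\<^sup>2)) + 3 * lam1\<^sup>2 + 3 * lam2\<^sup>2 - 12 * lam1 * lam2 \<and>
           (\<exists>c1 c2. \<forall>t\<in>I. \<psi> t = c1 * exp (3/4 * (lam1 + lam2) * t) * cos (1/2 * sqrt (- D) * t)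
                                + c2 * exp (3/4 * (lam1 + lam2) * t) * sin (1/2 * sqrt (- D) * t)))))"
proof -
  let ?K = "3 * (lam1\<^sup>2 + lam2\<^sup>2 - 4 * lam1 * lam2)"
  let ?l = "lam1 + lam2"
  note I = assms(1-3)
  have \<phi>: "smooth_on I \<phi>" "\<And>t. t \<in> I \<Longrightarrow> \<phi> t > 0" using assms by auto
  obtain f f' where f: "\<And>t. t \<in> I \<Longrightarrow> (\<phi> has_real_derivative f t * \<phi> t) (at t)"
    and f': "\<And>t. t \<in> I \<Longrightarrow> (f has_real_derivative f' t) (at t)"
    using log_derivative[OF I(1) \<phi>] by metis
  have const: "has_constant_scalar_curvature M g (\<lambda>i. quarter_symmetric (g i) d_dt lam1 lam2) S \<longleftrightarrow>
      (\<forall>t\<in>I. - 2 * \<zeta> * f' t - (\<eta> + \<zeta>\<^sup>2) * (f t)\<^sup>2 + 3 * ?l * \<zeta> * f t + ?K = S)"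
    unfolding \<open>M = _\<close> \<open>g = _\<close> \<open>\<zeta> = _\<close> \<open>\<eta> = _\<close>
    by (rule kasner_constant_scalar_curvature_iff[OF I(1) \<phi> assms(6-11) f f'])
  have "\<eta> \<ge> 0" by (simp add: \<open>\<eta> = _\<close>)
  show ?thesis
  proof (cases "\<zeta> = 0")
    case True
    have cont_f: "continuous_on I f"
      using f' by (meson DERIV_isCont continuous_at_imp_continuous_on)
    have const0: "has_constant_scalar_curvature M g (\<lambda>i. quarter_symmetric (g i) d_dt lam1 lam2) S \<longleftrightarrow>
        (\<forall>t\<in>I. \<eta> * (f t)\<^sup>2 = ?K - S)"
      unfolding const by (auto simp: True)
    consider "\<eta> = 0" | "\<eta> > 0" "S > ?K" | "\<eta> > 0" "S = ?K" | "\<eta> > 0" "S < ?K"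
      using \<open>\<eta> \<ge> 0\<close> by linarith
    then show ?thesis
    proof cases
      case 1
      then show ?thesis unfolding const0 using True \<open>I \<noteq> {}\<close> by auto
    next
      case 2
      \<comment> \<open>A nonnegative number would equal a negative one; with a point in
        \<open>I\<close> this refutes constancy.\<close>
      have "\<eta> * (f t)\<^sup>2 \<noteq> ?K - S" for t
        using 2 by (smt (verit) mult_nonneg_nonneg zero_le_power2)
      then show ?thesis unfolding const0 using True 2 \<open>I \<noteq> {}\<close> by auto
    next
      case 3
      then have "(\<forall>t\<in>I. \<eta> * (f t)\<^sup>2 = ?K - S) \<longleftrightarrow> (\<forall>t\<in>I. f t = 0)" by simp
      \<comment> \<open>\<open>order_refl\<close> sets \<open>m\<close> to 0, where both
        exponentials reduce to 1.\<close>
      also have "\<dots> \<longleftrightarrow> (\<exists>c. \<forall>t\<in>I. \<phi> t = c)"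
        using log_derivative_square_constant[OF I order_refl f cont_f \<phi>(2)] by (simp add: ex_disj_distrib)
      finally show ?thesis unfolding const0 using True 3 by simp
    next
      case 4
      let ?m = "sqrt ((?K - S) / \<eta>)"
      have m: "?m\<^sup>2 = (?K - S) / \<eta>" "?m \<ge> 0" using 4 by simp_all
      have "(\<forall>t\<in>I. \<eta> * (f t)\<^sup>2 = ?K - S) \<longleftrightarrow> (\<forall>t\<in>I. (f t)\<^sup>2 = ?m\<^sup>2)"
        unfolding m(1) using 4 by (simp add: field_simps)
      also have "\<dots> \<longleftrightarrow> (\<exists>c. \<exists>s\<in>{1, -1}. \<forall>t\<in>I. \<phi> t = c * exp (s * ?m * t))"
        by (rule log_derivative_square_constant[OF I m(2) f cont_f \<phi>(2)])
      finally show ?thesis unfolding const0 using True 4 by simp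
    qed
  next
    case False
    define N where "N = \<eta> + \<zeta>\<^sup>2"
    have N: "N > 0" using False \<open>\<eta> \<ge> 0\<close> by (simp add: N_def add_nonneg_pos)
    \<comment> \<open>The inverse of the given exponent, so \<psi> is the power \<open>r\<close> of
      \<phi> and has logarithmic derivative \<open>r * f t\<close>. Its second derivative divided by
      \<psi> is \<open>r * (f' t + r * (f t)\<^sup>2)\<close>, and
      \<open>- 2 * \<zeta> * f' t - N * (f t)\<^sup>2\<close> is \<open>- 2 * \<zeta>\<close> times
      the same bracket: this dictates the exponent.\<close>
    define r where "r = N / (2 * \<zeta>)"
    have "r \<noteq> 0" using N False by (simp add: r_def)
    have \<psi>: "\<psi> t > 0" "\<phi> t = \<psi> t powr (1 / r)" if "t \<in> I" for t
      using assms(18) False that by (simp_all add: r_def N_def)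
    have \<psi>_eq: "\<phi> t powr r = \<psi> t" if "t \<in> I" for t
      using \<psi>[OF that] \<open>r \<noteq> 0\<close> by (simp add: powr_powr)
    have \<psi>': "(\<psi> has_real_derivative r * f t * \<psi> t) (at t)" if t: "t \<in> I" for t
      using powr_log_derivative[OF f[OF t] \<phi>(2)[OF t], of r] unfolding \<psi>_eq[OF t]
      by (rule has_field_derivative_transform_within_open[OF _ I(1) t \<psi>_eq])
    have \<psi>'': "((\<lambda>t. r * f t * \<psi> t) has_real_derivative
        r * (f' t + r * (f t)\<^sup>2) * \<psi> t) (at t)" if "t \<in> I" for t
      by (auto intro!: derivative_eq_intros \<psi>' f' that simp: power2_eq_square algebra_simps)
    \<comment> \<open>The midpoint of the characteristic roots; they are \<open>a\<close> plus and
      minus half a square root of \<open>D\<close>, so the constant coefficient is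
      \<open>a\<^sup>2 - D / 4\<close>.\<close>
    define a where "a = 3 / 4 * ?l"
    have a2: "4 * a\<^sup>2 = 9 * ?l\<^sup>2 / 4" by (simp add: a_def power2_eq_square algebra_simps)
    have D: "D = 4 * a\<^sup>2 - (S - ?K) * N / \<zeta>\<^sup>2"
    proof -
      have "S - ?K = S - 3 * lam1\<^sup>2 - 3 * lam2\<^sup>2 + 12 * lam1 * lam2" by simp
      then show ?thesis by (simp only: assms(19) N_def a2)
    qed
    have "(- 2 * \<zeta> * f' t - N * (f t)\<^sup>2 + 3 * ?l * \<zeta> * f t + ?K = S) \<longleftrightarrow>
        r * (f' t + r * (f t)\<^sup>2) * \<psi> t = 2 * a * (r * f t * \<psi> t) - (a\<^sup>2 - D / 4) * \<psi> t" (is "?L = ?R")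
      if t: "t \<in> I" for t
    proof -
      have "?R \<longleftrightarrow> (r * (f' t + r * (f t)\<^sup>2) - 2 * a * (r * f t) + (a\<^sup>2 - D / 4)) * \<psi> t = 0"
        by (simp add: algebra_simps)
      also have "\<dots> \<longleftrightarrow> r * (f' t + r * (f t)\<^sup>2) - 2 * a * (r * f t) + (a\<^sup>2 - D / 4) = 0"
        using \<psi>(1)[OF t] by simp
      \<comment> \<open>The two equations differ by the nonzero factor
        \<open>N / (4 * \<zeta>\<^sup>2)\<close>, besides the factor \<open>\<psi> t\<close> already
        cancelled.\<close>
      also have "r * (f' t + r * (f t)\<^sup>2) - 2 * a * (r * f t) + (a\<^sup>2 - D / 4) =
          N / (4 * \<zeta>\<^sup>2) * (S - (- 2 * \<zeta> * f' t - N * (f t)\<^sup>2 + 3 * ?l * \<zeta> * f t + ?K))"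
        using False by (simp add: D r_def a_def field_simps power2_eq_square)
      also have "\<dots> = 0 \<longleftrightarrow> ?L" using N False by auto
      finally show ?thesis by blast
    qed
    then have const1: "has_constant_scalar_curvature M g (\<lambda>i. quarter_symmetric (g i) d_dt lam1 lam2) S \<longleftrightarrow>
        (\<forall>t\<in>I. r * (f' t + r * (f t)\<^sup>2) * \<psi> t = 2 * a * (r * f t * \<psi> t) - (a\<^sup>2 - D / 4) * \<psi> t)"
      unfolding const by (simp add: N_def)
    let ?B = "9 * \<zeta>\<^sup>2 * ?l\<^sup>2 / (4 * (\<eta> + \<zeta>\<^sup>2)) + 3 * lam1\<^sup>2 + 3 * lam2\<^sup>2 - 12 * lam1 * lam2"
    \<comment> \<open>The threshold \<open>?B\<close> is the value of \<open>S\<close> at which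
      \<open>D\<close> vanishes, and \<open>D\<close> is a positive multiple of
      \<open>?B - S\<close>; the three ranges of \<open>S\<close> are thus the three signs of the
      discriminant.\<close>
    have DB: "D = (?B - S) * (N / \<zeta>\<^sup>2)"
    proof -
      have "?B = 9 * \<zeta>\<^sup>2 * ?l\<^sup>2 / (4 * N) + ?K" by (simp add: N_def)
      moreover have "9 * \<zeta>\<^sup>2 * ?l\<^sup>2 / (4 * N) * (N / \<zeta>\<^sup>2) = 4 * a\<^sup>2"
        unfolding a2 using False N by simp
      moreover have "(x + ?K - S) * (N / \<zeta>\<^sup>2) = x * (N / \<zeta>\<^sup>2) - (S - ?K) * N / \<zeta>\<^sup>2" for x
        by (simp add: left_diff_distrib distrib_right diff_divide_distrib add_divide_distrib)
      ultimately show ?thesis by (simp only: D)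
    qed
    have sgn: "S < ?B \<longleftrightarrow> D > 0" "S = ?B \<longleftrightarrow> D = 0" "S > ?B \<longleftrightarrow> D < 0"
    proof -
      have "N / \<zeta>\<^sup>2 > 0" using False N by simp
      then have "S < y \<longleftrightarrow> (y - S) * (N / \<zeta>\<^sup>2) > 0" "S = y \<longleftrightarrow> (y - S) * (N / \<zeta>\<^sup>2) = 0"
        "S > y \<longleftrightarrow> (y - S) * (N / \<zeta>\<^sup>2) < 0" for y
        by (simp_all only: zero_less_mult_iff mult_less_0_iff mult_eq_0_iff) auto
      then show "S < ?B \<longleftrightarrow> D > 0" "S = ?B \<longleftrightarrow> D = 0" "S > ?B \<longleftrightarrow> D < 0"
        unfolding DB by blast+
    qed
    note ode = I(1,2) \<psi>' \<psi>''
    consider "D > 0" | "D = 0" | "D < 0" by linarith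
    then show ?thesis
    proof cases
      case 1
      have k: "(sqrt D / 2)\<^sup>2 = D / 4" "sqrt D / 2 \<noteq> 0" using 1 by (simp_all add: power_divide)
      have e: "1/2 * (3/2 * ?l + sqrt D) = a + sqrt D / 2" "1/2 * (3/2 * ?l - sqrt D) = a - sqrt D / 2"
        by (simp_all add: a_def)
      show ?thesis
        unfolding const1 sgn e
        using linear_ode_real_roots[OF ode k(2), of a] False 1 by (simp add: k(1))
    next
      case 2
      have e: "3 * ?l / 4 = a" by (simp add: a_def)
      show ?thesis
        unfolding const1 sgn e
        using linear_ode_double_root[OF ode, of a] False 2 by simp
    next
      case 3
      have k: "(1/2 * sqrt (- D))\<^sup>2 = - D / 4" "1/2 * sqrt (- D) \<noteq> 0"
        using 3 by (simp_all add: power_divide)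
      show ?thesis
        unfolding const1 sgn a_def[symmetric]
        using linear_ode_complex_roots[OF ode k(2), of a] False 3 unfolding k(1) by simp
    qed
  qed
qed

end
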